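(* Let $\mathcal K(x)=\sigma(x)/|x|^n$ on $\mathbb{R}^n\setminus\{0\}$, where $\sigma$ is infinitely differentiable on $\mathbb{R}^n\setminus\{0\}$, satisfies $\sigma(tx)=\sigma(x)$ for all $t>0$, and $\int_{S}\sigma\,dS=0$ with $S$ the unit sphere. Let $\varpi$ be an oscillation function on $[0,R)$ satisfying: (a) $\int_0^R\varpi(r)\,\frac{dr}{r}<\infty$; (b) $\lim_{r\to0}\varpi(r)/r=+\infty$; (c) there are $k_1>1$ and $c_1>0$ with $\varpi(k_1r)\le c_1\varpi(r)$ for $r$ in a neighborhood of the origin; (d) there is $C_2>0$ with $B(r):=\dfrac{r\int_r^R\frac{\varpi(s)}{s^2}ds}{\int_0^r\frac{\varpi(s)}{s}ds}\le C_2$ for $r$ in a neighborhood of the origin. Let $\hat\varpi(r)=\int_0^r\varpi(s)\frac{ds}{s}$. Let $\rho>0$, $I(\rho)=\{x:|x|\le\rho\}$, and let $\phi\in D_{\varpi}(I(\rho))$ vanish for $|x|\ge\rho$ (extended by zero to $\mathbb{R}^n$). Then $\mathcal K*\phi$, defined by $(\mathcal K*\phi)(x)=\int\mathcal K(x-y)\phi(y)\,dy$ as a Cauchy principal value, belongs to $D_{\hat\varpi}(I(\rho))$, and in $I(\rho)$ $$[\mathcal K*\phi]_{\hat\varpi}\le C\,\|\phi\|_{\varpi},$$ where $C=C(n,\varpi,|||\sigma|||)$ and $|||\sigma|||$ is the sum of the $L^\infty$ norms on the unit sphere of $\sigma$ and of its first order derivatives.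
   Context: An oscillation function is a real, continuous, non-decreasing function $\varpi$ defined on $[0,R)$ for some $R>0$, with $\varpi(0)=0$ and $\varpi(r)>0$ for $r>0$. For a set $E$ and $f\in C(\overline E)$ set $\omega_f(r)=\sup\{|f(x)-f(y)|: x,y\in E,\ 0<|x-y|\le r\}$, $[f]_{\varpi}=\sup_{0<r<R}\omega_f(r)/\varpi(r)$, $D_{\varpi}(\overline E)=\{f\in C(\overline E): [f]_{\varpi}<\infty\}$, $\|f\|_{\varpi}=[f]_{\varpi}+\sup|f|$; the same with $\hat\varpi$ in place of $\varpi$. Here $E=I(\rho)$. *)

theory Defs
  imports "HOL-Analysis.Analysis"
begin

definition oscillation_function :: "(real \<Rightarrow> real) \<Rightarrow> real \<Rightarrow> bool" where
  "oscillation_function w R \<longleftrightarrow> R > 0 \<and> continuous_on {0..<R} w \<and> mono_on {0..<R} w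
     \<and> w 0 = 0 \<and> (\<forall>r\<in>{0<..<R}. w r > 0)"

definition modcont :: "'a::real_normed_vector set \<Rightarrow> ('a \<Rightarrow> real) \<Rightarrow> real \<Rightarrow> real" where
  "modcont E f r = Sup {\<bar>f x - f y\<bar> | x y. x \<in> E \<and> y \<in> E \<and> 0 < norm (x - y) \<and> norm (x - y) \<le> r}"

definition wsemi :: "(real \<Rightarrow> real) \<Rightarrow> real \<Rightarrow> 'a::real_normed_vector set \<Rightarrow> ('a \<Rightarrow> real) \<Rightarrow> real" where
  "wsemi w R E f = (SUP r\<in>{0<..<R}. modcont E f r / w r)"

definition inD :: "(real \<Rightarrow> real) \<Rightarrow> real \<Rightarrow> 'a::real_normed_vector set \<Rightarrow> ('a \<Rightarrow> real) \<Rightarrow> bool" where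
  "inD w R E f \<longleftrightarrow> continuous_on E f \<and> bdd_above ((\<lambda>r. modcont E f r / w r) ` {0<..<R})"

definition wnorm :: "(real \<Rightarrow> real) \<Rightarrow> real \<Rightarrow> 'a::real_normed_vector set \<Rightarrow> ('a \<Rightarrow> real) \<Rightarrow> real" where
  "wnorm w R E f = wsemi w R E f + (SUP x\<in>E. \<bar>f x\<bar>)"

fun Ck_on :: "nat \<Rightarrow> 'a::euclidean_space set \<Rightarrow> ('a \<Rightarrow> real) \<Rightarrow> bool" where
  "Ck_on 0 S f = continuous_on S f"
| "Ck_on (Suc k) S f = (f differentiable_on S \<and>
      (\<forall>i\<in>Basis. Ck_on k S (\<lambda>x. frechet_derivative f (at x) i)))"

definition smooth_on :: "'a::euclidean_space set \<Rightarrow> ('a \<Rightarrow> real) \<Rightarrow> bool" where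
  "smooth_on S f \<longleftrightarrow> (\<forall>k. Ck_on k S f)"

text \<open>Integral over the unit sphere w.r.t. surface measure, via polar coordinates:
  int_S g dS = n * int_{|x|<1} g(x/|x|) dx.\<close>
definition sphere_integral :: "('a::euclidean_space \<Rightarrow> real) \<Rightarrow> real" where
  "sphere_integral g = real DIM('a) * integral (ball 0 1) (\<lambda>x. g (x /\<^sub>R norm x))"

definition triple_norm :: "('a::euclidean_space \<Rightarrow> real) \<Rightarrow> real" where
  "triple_norm s = (SUP x\<in>sphere 0 1. \<bar>s x\<bar>)
     + (\<Sum>i\<in>Basis. SUP x\<in>sphere 0 1. \<bar>frechet_derivative s (at x) i\<bar>)"

definition kernel :: "('a::euclidean_space \<Rightarrow> real) \<Rightarrow> 'a \<Rightarrow> real" where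
  "kernel s x = s x / norm x ^ DIM('a)"

definition pv_conv_at :: "('a::euclidean_space \<Rightarrow> real) \<Rightarrow> ('a \<Rightarrow> real) \<Rightarrow> 'a \<Rightarrow> real \<Rightarrow> bool" where
  "pv_conv_at s phi x v \<longleftrightarrow>
     (\<forall>e>0. (\<lambda>y. kernel s (x - y) * phi y) integrable_on {y. e \<le> norm (x - y)}) \<and>
     ((\<lambda>e. integral {y. e \<le> norm (x - y)} (\<lambda>y. kernel s (x - y) * phi y)) \<longlongrightarrow> v) (at_right 0)"

end

theory Submission
  imports Defs
begin

text \<open>Write \<open>K\<close> for the kernel and \<open>n\<close> for the dimension, and for \<open>h > 0\<close> let
  \<open>K\<^sub>h(z) = \<sigma>(z) |z| / max(|z|, h)^(n+1)\<close>, which agrees with \<open>K\<close> outside the ball of radius \<open>h\<close>.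
  Since \<open>K - K\<^sub>h\<close> is \<open>\<sigma>\<close> times a radial function, mean zero gives
  \<open>K*\<phi>(x) = \<integral> (K - K\<^sub>h)(z) (\<phi>(x-z) - \<phi>(x)) dz + \<integral> K\<^sub>h(z) \<phi>(x-z) dz\<close> for every \<open>h < R\<close>.
  To compare two points at distance \<open>h\<close>, use this very \<open>h\<close>. The first integral is at most a constant
  times the integral of \<open>\<varpi>(s)/s\<close> over \<open>[0,h]\<close>. In the second, the increment
  \<open>\<Delta>(z) = K\<^sub>h(z) - K\<^sub>h(z+d)\<close> with \<open>|d| = h\<close> has integral zero and is \<open>O(h / max(|z|,h)^(n+1))\<close>,
  so that \<open>\<integral> \<Delta>(z) (\<phi>(x-z) - \<phi>(x)) dz\<close> is controlled by the same quantity, by \<open>h\<close> times the integral of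
  \<open>\<varpi>(s)/s\<^sup>2\<close> over \<open>[h,R]\<close>, which condition (d) absorbs, and by \<open>h sup|\<phi>|\<close>, which condition (b) absorbs.
  Larger distances are reached by a chain of short steps; their number depends on \<open>\<varpi>\<close> and \<open>R\<close> only, not on \<open>\<rho>\<close>.\<close>

section \<open>Radial integration\<close>

lemma nn_integral_lborel_scaleR:
  fixes f :: "'a::euclidean_space \<Rightarrow> ennreal"
  assumes [measurable]: "f \<in> borel_measurable borel" and c: "c \<noteq> 0"
  shows "(\<integral>\<^sup>+x. f x \<partial>lborel) = ennreal (\<bar>c\<bar> ^ DIM('a)) * (\<integral>\<^sup>+x. f (c *\<^sub>R x) \<partial>lborel)"
  by (subst lborel_affine[OF c, of 0])
     (simp add: nn_integral_density nn_integral_distr nn_integral_cmult)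

lemma distr_lborel_reflect:
  fixes x :: "'a::euclidean_space"
  shows "distr lborel borel (\<lambda>z. x - z) = lborel"
  by (subst (2) lborel_affine[of "-1" x]) (simp_all add: density_1)

lemma integrable_lborel_reflect_iff:
  fixes f :: "'a::euclidean_space \<Rightarrow> real"
  shows "integrable lborel (\<lambda>z. f (x - z)) \<longleftrightarrow> integrable lborel f"
proof -
  have *: "integrable lborel (\<lambda>z. f (x - z))" if "integrable lborel f" for f :: "'a \<Rightarrow> real" and x
  proof -
    have "integrable (distr lborel borel (\<lambda>z. x - z)) f"
      using that by (simp add: distr_lborel_reflect)
    then show ?thesis
      by (subst (asm) integrable_distr_eq) (use that in auto)
  qed
  show ?thesis
    using *[of f x] *[of "\<lambda>z. f (x - z)" x] by auto
qed

lemma integral_lborel_reflect: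
  fixes f :: "'a::euclidean_space \<Rightarrow> real"
  assumes [measurable]: "f \<in> borel_measurable borel"
  shows "(\<integral>z. f (x - z) \<partial>lborel) = (\<integral>z. f z \<partial>lborel)"
  by (subst (2) distr_lborel_reflect[of x, symmetric]) (simp add: integral_distr)

lemma integrable_lborel_translate:
  fixes f :: "'a::euclidean_space \<Rightarrow> real"
  assumes "integrable lborel f"
  shows "integrable lborel (\<lambda>z. f (z + d))"
proof -
  have "integrable lborel (\<lambda>z. f (d - z))"
    using assms by (simp add: integrable_lborel_reflect_iff)
  then have "integrable lborel (\<lambda>z. f (d - (0 - z)))"
    by (subst integrable_lborel_reflect_iff)
  then show ?thesis by (simp add: add.commute)
qed

lemma integral_lborel_translate:
  fixes f :: "'a::euclidean_space \<Rightarrow> real"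
  assumes [measurable]: "f \<in> borel_measurable borel"
  shows "(\<integral>z. f (z + d) \<partial>lborel) = (\<integral>z. f z \<partial>lborel)"
  by (subst (2) lborel_distr_plus[of d, symmetric])
     (simp add: integral_distr add.commute)

text \<open>Polar coordinates: the pushforward of \<open>q(z) dz\<close> under the norm and the measure with density
  proportional to \<open>n s^(n-1)\<close> agree on the intervals \<open>{..<r}\<close> by scaling.\<close>

lemma nn_integral_radial:
  fixes q :: "'a::euclidean_space \<Rightarrow> real" and g :: "real \<Rightarrow> real"
  assumes [measurable]: "q \<in> borel_measurable borel" "g \<in> borel_measurable borel"
    and q0: "\<And>z. 0 \<le> q z" and qM: "\<And>z. q z \<le> M"
    and hom: "\<And>t z. 0 < t \<Longrightarrow> q (t *\<^sub>R z) = q z"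
    and g0: "\<And>s. 0 \<le> g s"
  shows "(\<integral>\<^sup>+z. ennreal (g (norm z) * q z) \<partial>lborel) =
    (\<integral>\<^sup>+z. ennreal (indicator (ball 0 1) z * q z) \<partial>lborel) *
    (\<integral>\<^sup>+s. ennreal (indicator {0<..} s * (real DIM('a) * s ^ (DIM('a) - 1)) * g s) \<partial>lborel)"
proof -
  let ?n = "DIM('a)"
  define A where "A = (\<integral>\<^sup>+z. ennreal (indicator (ball (0::'a) 1) z * q z) \<partial>lborel)"
  define p where "p = (\<lambda>s::real. indicator {0<..} s * (real ?n * s ^ (?n - 1)))"
  have [measurable]: "p \<in> borel_measurable borel" by (simp add: p_def)
  have p0: "0 \<le> p s" for s by (simp add: p_def indicator_def)
  have M0: "0 \<le> M" using q0 qM order_trans by blast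
  \<comment> \<open>Uniqueness of measures on a generator needs finite mass on the exhausting
    intervals \<open>{..<real i}\<close>; this comes from the bound \<open>M\<close> and the finite
    volume of the unit ball.\<close>
  have A_fin: "A \<noteq> \<infinity>"
  proof -
    have "A \<le> (\<integral>\<^sup>+z. ennreal M * indicator (ball (0::'a) 1) z \<partial>lborel)"
      unfolding A_def using qM M0
      by (intro nn_integral_mono) (auto simp: indicator_def ennreal_leI)
    also have "\<dots> = ennreal M * emeasure lborel (ball (0::'a) 1)"
      by (subst nn_integral_cmult_indicator) auto
    also have "\<dots> < \<infinity>"
      using emeasure_bounded_finite[of "ball (0::'a) 1"] by (simp add: ennreal_mult_less_top)
    finally show ?thesis by simp
  qed
  define m1 where "m1 = distr (density lborel (\<lambda>z. ennreal (q z))) borel (norm :: 'a \<Rightarrow> real)"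
  define m2 where "m2 = density lborel (\<lambda>s. A * ennreal (p s))"
  have m1: "emeasure m1 {..<r} = (if 0 < r then ennreal (r ^ ?n) * A else 0)" for r
  proof -
    have [measurable]: "ball (0::'a) r \<in> sets borel"
      by simp
    have [simp]: "norm -` {..<r} = ball (0::'a) r"
      by auto
    have "emeasure m1 {..<r} = (\<integral>\<^sup>+z. ennreal (indicator (ball (0::'a) r) z * q z) \<partial>lborel)"
      unfolding m1_def
      by (subst emeasure_distr, simp, simp, subst emeasure_density)
         (auto intro!: nn_integral_cong simp: indicator_def)
    also have "\<dots> = (if 0 < r then ennreal (r ^ ?n) * A else 0)"
    proof (cases "0 < r")
      case True
      have "(\<integral>\<^sup>+z. ennreal (indicator (ball (0::'a) r) z * q z) \<partial>lborel) =
          ennreal (\<bar>r\<bar> ^ ?n) * (\<integral>\<^sup>+z. ennreal (indicator (ball (0::'a) r) (r *\<^sub>R z) * q (r *\<^sub>R z)) \<partial>lborel)"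
        by (rule nn_integral_lborel_scaleR, measurable) (use True in auto)
      also have "(\<lambda>z. ennreal (indicator (ball (0::'a) r) (r *\<^sub>R z) * q (r *\<^sub>R z))) =
          (\<lambda>z. ennreal (indicator (ball (0::'a) 1) z * q z))"
        using True hom by (auto simp: indicator_def fun_eq_iff)
      finally show ?thesis using True by (simp add: A_def)
    next
      case False
      then have "ball (0::'a) r = {}" by simp
      then show ?thesis unfolding \<open>ball 0 r = {}\<close> using False by simp
    qed
    finally show ?thesis .
  qed
  have m2: "emeasure m2 {..<r} = (if 0 < r then ennreal (r ^ ?n) * A else 0)" for r
  proof -
    have "emeasure m2 {..<r} = A * (\<integral>\<^sup>+s. ennreal (p s) * indicator {..<r} s \<partial>lborel)"
      unfolding m2_def by (subst emeasure_density) (auto simp: mult.assoc nn_integral_cmult)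
    also have "(\<integral>\<^sup>+s. ennreal (p s) * indicator {..<r} s \<partial>lborel) = (if 0 < r then ennreal (r ^ ?n) else 0)"
    proof (cases "0 < r")
      case True
      have "(\<integral>\<^sup>+s. ennreal (p s) * indicator {..<r} s \<partial>lborel) =
          (\<integral>\<^sup>+s. ennreal (real ?n * s ^ (?n - 1)) * indicator {0..r} s \<partial>lborel)"
        \<comment> \<open>The cutoff \<open>0 < s\<close> in \<open>p\<close> together with
          \<open>{..<r}\<close> differs from \<open>{0..r}\<close> only at the two end points, hence
          the two exceptional singletons.\<close>
        by (rule nn_integral_cong_AE, rule AE_mp[OF AE_lborel_singleton[of 0] AE_mp[OF AE_lborel_singleton[of r]]])
           (auto simp: p_def indicator_def)
      also have "\<dots> = ennreal (r ^ ?n - 0 ^ ?n)"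
        using True by (intro nn_integral_FTC_Icc) (auto intro!: derivative_eq_intros)
      finally show ?thesis using True by simp
    next
      case False
      then have "(\<lambda>s. ennreal (p s) * indicator {..<r} s) = (\<lambda>s. 0)"
        by (auto simp: p_def indicator_def)
      then show ?thesis using False by simp
    qed
    finally show ?thesis by (simp add: mult.commute)
  qed
  have "m1 = m2"
  proof (rule measure_eqI_generator_eq[where E = "range lessThan" and \<Omega> = UNIV and A = "\<lambda>i. {..<real i}"])
    show "Int_stable (range lessThan :: real set set)"
    proof (rule Int_stableI)
      fix a b :: "real set" assume "a \<in> range lessThan" "b \<in> range lessThan"
      then obtain u v where "a = {..<u}" "b = {..<v}" by blast
      then have "a \<inter> b = {..<min u v}" by auto
      then show "a \<inter> b \<in> range lessThan" by blast
    qed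
    show "sets m1 = sigma_sets UNIV (range lessThan)"
      unfolding m1_def by (simp add: borel_Iio)
    show "sets m2 = sigma_sets UNIV (range lessThan)"
      unfolding m2_def by (simp add: borel_Iio)
    show "(\<Union>i. {..<real i}) = UNIV"
      by (auto intro: reals_Archimedean2)
    show "emeasure m1 {..<real i} \<noteq> \<infinity>" for i
      using A_fin by (simp add: m1 ennreal_mult_eq_top_iff)
  qed (auto simp: m1 m2)
  have "(\<integral>\<^sup>+z. ennreal (g (norm z) * q z) \<partial>lborel) = (\<integral>\<^sup>+s. ennreal (g s) \<partial>m1)"
    unfolding m1_def
    by (simp add: nn_integral_distr nn_integral_density ennreal_mult' q0 g0 mult.commute ennreal_mult'')
  also have "\<dots> = (\<integral>\<^sup>+s. A * (ennreal (p s) * ennreal (g s)) \<partial>lborel)"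
    unfolding \<open>m1 = m2\<close> m2_def by (simp add: nn_integral_density mult.assoc)
  also have "\<dots> = A * (\<integral>\<^sup>+s. ennreal (p s * g s) \<partial>lborel)"
    by (simp add: nn_integral_cmult ennreal_mult' p0)
  finally show ?thesis by (simp add: A_def p_def)
qed

lemma nn_integral_norm:
  fixes g :: "real \<Rightarrow> real"
  assumes [measurable]: "g \<in> borel_measurable borel" and g0: "\<And>s. 0 \<le> g s"
  shows "(\<integral>\<^sup>+z. ennreal (g (norm (z::'a::euclidean_space))) \<partial>lborel) =
    ennreal (real DIM('a) * unit_ball_vol (real DIM('a))) *
    (\<integral>\<^sup>+s. ennreal (indicator {0<..} s * s ^ (DIM('a) - 1) * g s) \<partial>lborel)"
proof -
  have "(\<integral>\<^sup>+z. ennreal (g (norm (z::'a)) * 1) \<partial>lborel) =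
    (\<integral>\<^sup>+z. ennreal (indicator (ball 0 1) (z::'a) * 1) \<partial>lborel) *
    (\<integral>\<^sup>+s. ennreal (indicator {0<..} s * (real DIM('a) * s ^ (DIM('a) - 1)) * g s) \<partial>lborel)"
    by (rule nn_integral_radial[where M = 1]) (auto simp: g0)
  also have "(\<integral>\<^sup>+z. ennreal (indicator (ball 0 1) (z::'a) * 1) \<partial>lborel) = ennreal (unit_ball_vol (real DIM('a)))"
    using emeasure_ball[of 1 "0::'a"] by (simp add: ennreal_indicator)
  also have "(\<integral>\<^sup>+s. ennreal (indicator {0<..} s * (real DIM('a) * s ^ (DIM('a) - 1)) * g s) \<partial>lborel) =
      (\<integral>\<^sup>+s. ennreal (real DIM('a)) * ennreal (indicator {0<..} s * s ^ (DIM('a) - 1) * g s) \<partial>lborel)"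
    by (intro nn_integral_cong) (simp add: ennreal_mult' [symmetric] mult_ac)
  also have "\<dots> = ennreal (real DIM('a)) * (\<integral>\<^sup>+s. ennreal (indicator {0<..} s * s ^ (DIM('a) - 1) * g s) \<partial>lborel)"
    by (simp add: nn_integral_cmult)
  finally show ?thesis
    by (simp add: ennreal_mult' mult_ac)
qed

lemma integrable_lborel_bounded_support:
  fixes f :: "'a::euclidean_space \<Rightarrow> real"
  assumes [measurable]: "f \<in> borel_measurable borel"
    and bound: "\<And>z. \<bar>f z\<bar> \<le> B" and supp: "\<And>z. D < norm z \<Longrightarrow> f z = 0"
  shows "integrable lborel f"
proof (rule Bochner_Integration.integrable_bound)
  show "integrable lborel (\<lambda>z. B * indicator (cball (0::'a) D) z)"
    using emeasure_bounded_finite[of "cball (0::'a) D"]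
    by (intro integrable_mult_right integrable_real_indicator) auto
  show "AE z in lborel. norm (f z) \<le> norm (B * indicator (cball 0 D) z)"
  proof (rule AE_I2)
    fix z
    show "norm (f z) \<le> norm (B * indicator (cball 0 D) z)"
      using bound[of z] supp[of z] by (cases "norm z \<le> D") auto
  qed
qed simp

text \<open>Induction through a^(k+2) - b^(k+2) = a (a^(k+1) - b^(k+1)) + (a - b) b^(k+1). Writing
  the exponent as \<open>Suc k\<close> keeps truncated subtraction out of the power of
  \<open>c\<close>.\<close>

lemma abs_power_diff_le:
  fixes a b c :: real
  assumes "0 \<le> a" "a \<le> c" "0 \<le> b" "b \<le> c"
  shows "\<bar>a ^ Suc k - b ^ Suc k\<bar> \<le> real (Suc k) * \<bar>a - b\<bar> * c ^ k"
proof (induction k)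
  case (Suc k)
  have "a ^ Suc (Suc k) - b ^ Suc (Suc k) = a * (a ^ Suc k - b ^ Suc k) + (a - b) * b ^ Suc k"
    by (simp add: algebra_simps)
  then have "\<bar>a ^ Suc (Suc k) - b ^ Suc (Suc k)\<bar> \<le> \<bar>a * (a ^ Suc k - b ^ Suc k)\<bar> + \<bar>(a - b) * b ^ Suc k\<bar>"
    by (simp only: abs_triangle_ineq)
  also have "\<bar>a * (a ^ Suc k - b ^ Suc k)\<bar> = a * \<bar>a ^ Suc k - b ^ Suc k\<bar>"
    using assms by (simp add: abs_mult)
  also have "\<dots> \<le> c * (real (Suc k) * \<bar>a - b\<bar> * c ^ k)"
    using assms by (intro mult_mono Suc) auto
  also have "\<bar>(a - b) * b ^ Suc k\<bar> \<le> \<bar>a - b\<bar> * c ^ Suc k"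
    unfolding abs_mult power_abs using assms by (intro mult_left_mono power_mono) auto
  finally show ?case by (simp add: algebra_simps)
qed simp

section \<open>Homogeneous kernels of mean zero\<close>

text \<open>Constant of the increment estimate for \<open>reg_kernel\<close>. The 5 is 4 + 1 from
  the numerator (\<open>s_lipschitz\<close> and \<open>s_bound\<close>); the rest comes from the
  denominator, with its exponent n+1 and a factor 2^n because a shift of length at most
  \<open>h\<close> changes max(|z|, h) by a factor of at most 2.\<close>

definition lip_const :: "'a::euclidean_space itself \<Rightarrow> real" where
  "lip_const _ = 5 + (1 + real DIM('a)) * 2 ^ DIM('a)"

lemma lip_const_pos: "0 < lip_const TYPE('a::euclidean_space)"
  by (simp add: lip_const_def add_pos_nonneg)

text \<open>What the estimates need of the symbol, for a function defined at 0 too. By homogeneity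
  the mean over the unit ball stands for the mean over the sphere. \<open>s_lipschitz\<close> is the
  scale-invariant form of a gradient bound of order 1/|z|, valid for all pairs, even when the
  segment joining them meets the origin.\<close>

locale singular_kernel =
  fixes s :: "'a::euclidean_space \<Rightarrow> real" and M :: real
  assumes s_measurable [measurable]: "s \<in> borel_measurable borel"
    and s_bound: "\<And>z. \<bar>s z\<bar> \<le> M"
    and s_homogeneous: "\<And>t z. 0 < t \<Longrightarrow> s (t *\<^sub>R z) = s z"
    and s_mean: "(\<integral>z. indicator (ball 0 1) z * s z \<partial>lborel) = 0"
    and s_lipschitz: "\<And>z z'. \<bar>s z - s z'\<bar> * norm z \<le> 4 * M * norm (z - z')"
begin

lemma M_nonneg: "0 \<le> M"
  using s_bound[of 0] by linarith

text \<open>Mean zero recast for nonnegative integrals, so that polar coordinates can be applied to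
  the positive and the negative part separately.\<close>

lemma nn_integral_ball_pos_neg:
  "(\<integral>\<^sup>+z. ennreal (indicator (ball 0 1) z * max 0 (s z)) \<partial>lborel) =
   (\<integral>\<^sup>+z. ennreal (indicator (ball 0 1) z * max 0 (- s z)) \<partial>lborel)"
proof -
  let ?b = "indicator (ball (0::'a) 1) :: 'a \<Rightarrow> real"
  have [measurable]: "ball (0::'a) 1 \<in> sets borel" by simp
  have int: "integrable lborel (\<lambda>z. ?b z * max 0 (s z))" "integrable lborel (\<lambda>z. ?b z * max 0 (- s z))"
    using s_bound M_nonneg
    by (intro integrable_lborel_bounded_support[where B = M and D = 1] borel_measurable_times;
        auto simp: indicator_def abs_le_iff)+
  have "(\<integral>z. ?b z * s z \<partial>lborel) = (\<integral>z. ?b z * max 0 (s z) - ?b z * max 0 (- s z) \<partial>lborel)"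
    by (intro Bochner_Integration.integral_cong) (auto simp: indicator_def)
  also have "\<dots> = (\<integral>z. ?b z * max 0 (s z) \<partial>lborel) - (\<integral>z. ?b z * max 0 (- s z) \<partial>lborel)"
    by (intro Bochner_Integration.integral_diff int)
  finally show ?thesis
    using s_mean by (subst (1 2) nn_integral_eq_integral) (use int in auto)
qed

text \<open>In polar coordinates the integrals against the positive and the negative part of
  \<open>s\<close> share their radial factor, and their angular factors agree by
  \<open>nn_integral_ball_pos_neg\<close>. Bound and support of \<open>g\<close> make both finite,
  so they cancel.\<close>

lemma radial_mean_zero:
  assumes [measurable]: "g \<in> borel_measurable borel"
    and g0: "\<And>t. 0 \<le> g t" and gB: "\<And>t. g t \<le> B" and supp: "\<And>t. D < t \<Longrightarrow> g t = 0"
  shows "integrable lborel (\<lambda>z. g (norm z) * s z)" "(\<integral>z. g (norm z) * s z \<partial>lborel) = 0"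
proof -
  have B0: "0 \<le> B" using g0 gB order_trans by blast
  have bd: "\<bar>g (norm z) * u\<bar> \<le> B * M" if "\<bar>u\<bar> \<le> M" for u and z :: 'a
    unfolding abs_mult using that g0[of "norm z"] gB[of "norm z"] B0 by (intro mult_mono) auto
  show "integrable lborel (\<lambda>z. g (norm z) * s z)"
    by (rule integrable_lborel_bounded_support[where B = "B * M" and D = D])
       (auto intro!: bd s_bound simp: supp)
  have "\<bar>max 0 (s z)\<bar> \<le> M" "\<bar>max 0 (- s z)\<bar> \<le> M" for z
    using s_bound[of z] by auto
  then have int: "integrable lborel (\<lambda>z. g (norm z) * max 0 (s z))" "integrable lborel (\<lambda>z. g (norm z) * max 0 (- s z))"
    by (intro integrable_lborel_bounded_support[where B = "B * M" and D = D];
        auto intro!: bd simp: supp)+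
  have "(\<integral>\<^sup>+z. ennreal (g (norm z) * max 0 (s z)) \<partial>lborel) =
      (\<integral>\<^sup>+z. ennreal (g (norm z) * max 0 (- s z)) \<partial>lborel)"
    using s_bound M_nonneg
    by (subst (1 2) nn_integral_radial[where M = M])
       (auto simp: nn_integral_ball_pos_neg s_homogeneous g0 abs_le_iff)
  then have eq: "(\<integral>z. g (norm z) * max 0 (s z) \<partial>lborel) = (\<integral>z. g (norm z) * max 0 (- s z) \<partial>lborel)"
    using int g0 by (subst (asm) (1 2) nn_integral_eq_integral) (auto simp: integral_nonneg)
  have "(\<integral>z. g (norm z) * s z \<partial>lborel) = (\<integral>z. g (norm z) * max 0 (s z) - g (norm z) * max 0 (- s z) \<partial>lborel)"
    by (intro Bochner_Integration.integral_cong) (auto simp: max_def)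
  also have "\<dots> = 0"
    using eq int by simp
  finally show "(\<integral>z. g (norm z) * s z \<partial>lborel) = 0" .
qed

text \<open>Truncating to \<open>\<sigma>(z) / max(|z|, h)^n\<close> would leave the discontinuity of \<open>\<sigma>\<close> at 0 in place,
  and the increment estimate would then lose a logarithm when \<open>n = 1\<close>; the factor \<open>|z|\<close> removes it.\<close>

definition reg_kernel :: "real \<Rightarrow> 'a \<Rightarrow> real" where
  "reg_kernel h z = s z * norm z / max (norm z) h ^ Suc DIM('a)"

text \<open>Radial profile of the difference between \<open>kernel s\<close> and
  \<open>reg_kernel h\<close>; being radial, it lets mean zero act on that difference.\<close>

definition gap :: "real \<Rightarrow> real \<Rightarrow> real" where
  "gap h t = (if 0 < t \<and> t < h then 1 / t ^ DIM('a) - t / h ^ Suc DIM('a) else 0)"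

lemma reg_kernel_measurable [measurable]: "reg_kernel h \<in> borel_measurable borel"
  unfolding reg_kernel_def[abs_def] by measurable

lemma gap_measurable [measurable]: "gap h \<in> borel_measurable borel"
  unfolding gap_def[abs_def] by measurable

lemma kernel_measurable [measurable]: "kernel s \<in> borel_measurable borel"
  unfolding kernel_def[abs_def] by measurable

lemma gap_nonneg: "0 \<le> gap h t"
proof (cases "0 < t \<and> t < h")
  case True
  then have "t * t ^ DIM('a) \<le> h * h ^ DIM('a)"
    by (intro mult_mono power_mono) auto
  then have "t / h ^ Suc DIM('a) \<le> 1 / t ^ DIM('a)"
    using True by (simp add: field_simps)
  then show ?thesis using True by (simp add: gap_def)
qed (auto simp: gap_def)

lemma gap_le: "gap h t \<le> indicator {0<..<h} t / t ^ DIM('a)"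
  by (auto simp: gap_def indicator_def)

lemma kernel_split: "kernel s z = gap h (norm z) * s z + reg_kernel h z"
proof (cases "z = 0")
  case False
  show ?thesis
  proof (cases "norm z < h")
    case True
    with False have "max (norm z) h = h" "0 < h" by (auto intro: le_less_trans[OF norm_ge_zero])
    with False True show ?thesis
      by (simp add: kernel_def gap_def reg_kernel_def field_simps)
  next
    case not: False
    then have "max (norm z) h = norm z" by simp
    with False not show ?thesis
      by (simp add: kernel_def gap_def reg_kernel_def field_simps)
  qed
\<comment> \<open>At the origin every term is 0; for \<open>kernel s\<close> this is division by
  zero.\<close>
qed (simp add: kernel_def gap_def reg_kernel_def)

lemma kernel_bound: "\<bar>kernel s z\<bar> \<le> M / norm z ^ DIM('a)"
  unfolding kernel_def abs_divide power_abs abs_norm_cancel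
  by (intro divide_right_mono s_bound) auto

lemma reg_kernel_bound:
  assumes "0 < h"
  shows "\<bar>reg_kernel h z\<bar> \<le> M / h ^ DIM('a)"
proof -
  let ?m = "max (norm z) h"
  have "\<bar>reg_kernel h z\<bar> \<le> M * ?m / ?m ^ Suc DIM('a)"
    unfolding reg_kernel_def abs_divide abs_mult power_abs abs_norm_cancel
    using assms M_nonneg by (intro divide_right_mono mult_mono s_bound frac_le) auto
  also have "\<dots> = M / ?m ^ DIM('a)"
    using assms by simp
  also have "\<dots> \<le> M / h ^ DIM('a)"
    using assms M_nonneg by (intro divide_left_mono power_mono) auto
  finally show ?thesis .
qed

text \<open>The difference of quotients splits into a change of numerator over a fixed denominator
  and a change of reciprocal denominators. The restriction \<open>norm d <= h\<close> makes the two
  maxima comparable, so that the bound can be stated at \<open>z\<close> alone.\<close>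

lemma reg_kernel_lipschitz:
  assumes d: "norm d \<le> h" and h: "0 < h"
  shows "\<bar>reg_kernel h z - reg_kernel h (z + d)\<bar> \<le> lip_const TYPE('a) * M * norm d / max (norm z) h ^ Suc DIM('a)"
proof -
  let ?N = "Suc DIM('a)"
  define z' where "z' = z + d"
  define m where "m = max (norm z) h"
  define m' where "m' = max (norm z') h"
  have zz: "\<bar>norm z' - norm z\<bar> \<le> norm d"
    using norm_triangle_ineq3[of z' z] by (simp add: z'_def)
  \<comment> \<open>The last claim holds because \<open>m <= m' + norm d\<close> and
    \<open>norm d <= h <= m'\<close>.\<close>
  have m: "0 < m" "0 < m'" "norm z' \<le> m'" "norm z \<le> m" and mm: "\<bar>m - m'\<bar> \<le> norm d" and m2: "m \<le> 2 * m'"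
    using zz h d by (auto simp: m_def m'_def)
  have num: "\<bar>s z * norm z - s z' * norm z'\<bar> \<le> 5 * M * norm d"
  proof -
    have "s z * norm z - s z' * norm z' = (s z - s z') * norm z + s z' * (norm z - norm z')"
      by (simp add: algebra_simps)
    also have "\<bar>\<dots>\<bar> \<le> \<bar>s z - s z'\<bar> * norm z + \<bar>s z'\<bar> * \<bar>norm z - norm z'\<bar>"
      by (rule order_trans[OF abs_triangle_ineq]) (simp add: abs_mult)
    also have "\<dots> \<le> 4 * M * norm (z - z') + M * norm d"
      using zz M_nonneg by (intro add_mono s_lipschitz mult_mono s_bound) auto
    finally show ?thesis by (simp add: z'_def norm_minus_commute algebra_simps)
  qed
  \<comment> \<open>Both bases are at most \<open>2 * m'\<close>, which gives the factor
    \<open>2 ^ DIM('a)\<close>; then \<open>norm z' <= m'\<close> supplies the remaining power that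
    cancels \<open>m' ^ ?N\<close>.\<close>
  have den: "norm z' * \<bar>1 / m ^ ?N - 1 / m' ^ ?N\<bar> \<le> (1 + real DIM('a)) * 2 ^ DIM('a) * norm d / m ^ ?N"
  proof -
    have "\<bar>m' ^ ?N - m ^ ?N\<bar> \<le> real ?N * \<bar>m' - m\<bar> * (2 * m') ^ DIM('a)"
      using m m2 by (intro abs_power_diff_le) auto
    also have "\<dots> \<le> real ?N * norm d * (2 * m') ^ DIM('a)"
      using mm m by (intro mult_right_mono mult_left_mono) auto
    finally have *: "\<bar>m' ^ ?N - m ^ ?N\<bar> \<le> (1 + real DIM('a)) * norm d * (2 ^ DIM('a) * m' ^ DIM('a))"
      by (simp add: power_mult_distrib)
    have "1 / m ^ ?N - 1 / m' ^ ?N = (m' ^ ?N - m ^ ?N) / (m ^ ?N * m' ^ ?N)"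
      using m by (simp add: diff_frac_eq)
    then have "norm z' * \<bar>1 / m ^ ?N - 1 / m' ^ ?N\<bar> = norm z' * (\<bar>m' ^ ?N - m ^ ?N\<bar> / (m ^ ?N * m' ^ ?N))"
      using m by (simp add: abs_mult)
    also have "\<dots> \<le> m' * ((1 + real DIM('a)) * norm d * (2 ^ DIM('a) * m' ^ DIM('a)) / (m ^ ?N * m' ^ ?N))"
      using m * by (intro mult_mono divide_right_mono) auto
    also have "\<dots> = (1 + real DIM('a)) * 2 ^ DIM('a) * norm d / m ^ ?N"
      using m by (simp add: field_simps)
    finally show ?thesis .
  qed
  have "reg_kernel h z - reg_kernel h z' =
      (s z * norm z - s z' * norm z') / m ^ ?N + s z' * (norm z' * (1 / m ^ ?N - 1 / m' ^ ?N))"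
    by (simp add: reg_kernel_def m_def m'_def algebra_simps diff_divide_distrib)
  then have "\<bar>reg_kernel h z - reg_kernel h z'\<bar> \<le>
      \<bar>s z * norm z - s z' * norm z'\<bar> / m ^ ?N + \<bar>s z'\<bar> * (norm z' * \<bar>1 / m ^ ?N - 1 / m' ^ ?N\<bar>)"
    using m by (simp add: abs_mult order_trans[OF abs_triangle_ineq] del: power_Suc)
  also have "\<dots> \<le> 5 * M * norm d / m ^ ?N + M * ((1 + real DIM('a)) * 2 ^ DIM('a) * norm d / m ^ ?N)"
    using m M_nonneg by (intro add_mono divide_right_mono num mult_mono s_bound den) auto
  also have "\<dots> = lip_const TYPE('a) * M * norm d / m ^ ?N"
    by (simp add: lip_const_def add_divide_distrib algebra_simps)
  finally show ?thesis by (simp add: z'_def m_def)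
qed

end

section \<open>Integrals of kernel weights, and cancellation in kernel increments\<close>

lemma has_integral_lborel_indicator:
  fixes f :: "'a::euclidean_space \<Rightarrow> real"
  assumes "integrable lborel (\<lambda>x. indicator S x * f x)"
  shows "(f has_integral (\<integral>x. indicator S x * f x \<partial>lborel)) S"
proof -
  have "(\<lambda>x. indicator S x * f x) = (\<lambda>x. if x \<in> S then f x else 0)"
    by auto
  then show ?thesis
    using has_integral_integral_lborel[OF assms] by (simp add: has_integral_restrict_UNIV)
qed

lemma nn_integral_inverse_square:
  fixes D e :: real
  assumes "0 < D" "0 \<le> e"
  shows "(\<integral>\<^sup>+t. ennreal (indicator {D..} t * (e / t\<^sup>2)) \<partial>lborel) = ennreal (e / D)"
proof -
  have "((\<lambda>t. - e / t) \<longlongrightarrow> 0) at_top"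
    by (intro tendsto_divide_0[OF tendsto_const] filterlim_at_top_imp_at_infinity filterlim_ident)
  then have "(\<integral>\<^sup>+t. ennreal (e / t\<^sup>2) * indicator {D..} t \<partial>lborel) = ennreal (0 - (- e / D))"
    using assms
    by (intro nn_integral_FTC_atLeast) (auto intro!: derivative_eq_intros simp: power2_eq_square)
  moreover have "(\<lambda>t. ennreal (indicator {D..} t * (e / t\<^sup>2))) = (\<lambda>t. ennreal (e / t\<^sup>2) * indicator {D..} t)"
    by (auto simp: indicator_def)
  ultimately show ?thesis by simp
qed

definition sphere_area :: "'a::euclidean_space itself \<Rightarrow> real" where
  "sphere_area _ = real DIM('a) * unit_ball_vol (real DIM('a))"

lemma sphere_area_nonneg: "0 \<le> sphere_area TYPE('a::euclidean_space)"
  by (simp add: sphere_area_def)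

text \<open>The increment bound h / max(t, h)^(n+1), multiplied by the polar Jacobian t^(n-1), is
  thus at most 1/t below \<open>h\<close> and h/t^2 above: the weights of \<open>hat w\<close> and
  of condition (d).\<close>

lemma radial_weight_le:
  fixes t h :: real
  assumes "0 < t" "0 < h"
  shows "t ^ (DIM('a::euclidean_space) - 1) / max t h ^ Suc DIM('a) \<le>
    indicator {0<..<h} t / (t * h) + indicator {h..} t / t\<^sup>2"
proof -
  define k where "k = DIM('a) - 1"
  have n: "DIM('a) = Suc k" by (simp add: k_def)
  show ?thesis
  proof (cases "t < h")
    case True
    have "t * t ^ k \<le> h * h ^ k"
      using True assms by (intro mult_mono power_mono) auto
    then show ?thesis
      using True assms unfolding n by (simp add: field_simps max_def)
  next
    case False
    then show ?thesis
      using assms unfolding n by (simp add: field_simps max_def power2_eq_square)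
  qed
qed

text \<open>With the Jacobian the integrand is at most e/D^2 below \<open>D\<close> and equals e/t^2
  above; each part contributes e/D, hence the factor 2.\<close>

lemma nn_integral_inverse_max_power:
  fixes D e :: real
  assumes D: "0 < D" and e: "0 \<le> e"
  shows "(\<integral>\<^sup>+z. ennreal (e / max (norm (z::'a::euclidean_space)) D ^ Suc DIM('a)) \<partial>lborel)
     \<le> ennreal (sphere_area TYPE('a) * (2 * e / D))"
proof -
  define k where "k = DIM('a) - 1"
  have n: "DIM('a) = Suc k" by (simp add: k_def)
  have pw: "indicator {0<..} t * t ^ k * (e / max t D ^ Suc (Suc k)) \<le>
      indicator {0..D} t * (e / D\<^sup>2) + indicator {D..} t * (e / t\<^sup>2)" for t
  proof (cases "0 < t")
    case True
    show ?thesis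
    proof (cases "t < D")
      case tD: True
      have "t ^ k * (e / D ^ Suc (Suc k)) \<le> D ^ k * (e / D ^ Suc (Suc k))"
        using True tD e by (intro mult_right_mono power_mono) auto
      then show ?thesis
        using True tD by (simp add: max_def power2_eq_square)
    next
      case False
      then show ?thesis using True e D by (simp add: max_def power2_eq_square indicator_def)
    qed
  qed (auto simp: indicator_def e)
  have "(\<integral>\<^sup>+t. ennreal (indicator {0<..} t * t ^ k * (e / max t D ^ Suc (Suc k))) \<partial>lborel) \<le>
      (\<integral>\<^sup>+t. ennreal (indicator {0..D} t * (e / D\<^sup>2)) + ennreal (indicator {D..} t * (e / t\<^sup>2)) \<partial>lborel)"
  proof (rule nn_integral_mono)
    fix t
    have "ennreal (indicator {0..D} t * (e / D\<^sup>2) + indicator {D..} t * (e / t\<^sup>2)) =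
        ennreal (indicator {0..D} t * (e / D\<^sup>2)) + ennreal (indicator {D..} t * (e / t\<^sup>2))"
      using e by (intro ennreal_plus) (auto simp: indicator_def)
    with ennreal_leI[OF pw[of t]]
    show "ennreal (indicator {0<..} t * t ^ k * (e / max t D ^ Suc (Suc k))) \<le>
        ennreal (indicator {0..D} t * (e / D\<^sup>2)) + ennreal (indicator {D..} t * (e / t\<^sup>2))"
      by simp
  qed
  also have "\<dots> = (\<integral>\<^sup>+t. ennreal (indicator {0..D} t * (e / D\<^sup>2)) \<partial>lborel) + ennreal (e / D)"
    unfolding nn_integral_inverse_square[OF D e, symmetric] by (rule nn_integral_add) auto
  also have "(\<lambda>t. ennreal (indicator {0..D} t * (e / D\<^sup>2))) = (\<lambda>t. ennreal (e / D\<^sup>2) * indicator {0..D} t)"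
    by (auto simp: indicator_def)
  also have "(\<integral>\<^sup>+t. ennreal (e / D\<^sup>2) * indicator {0..D} t \<partial>lborel) = ennreal (e / D)"
    using D e by (subst nn_integral_cmult_indicator) (auto simp: ennreal_mult'[symmetric] power2_eq_square)
  also have "ennreal (e / D) + ennreal (e / D) = ennreal (2 * e / D)"
    using D e by (simp add: ennreal_plus[symmetric] del: ennreal_plus)
  finally have *: "(\<integral>\<^sup>+t. ennreal (indicator {0<..} t * t ^ k * (e / max t D ^ Suc (Suc k))) \<partial>lborel) \<le> ennreal (2 * e / D)" .
  have "(\<integral>\<^sup>+z. ennreal (e / max (norm (z::'a)) D ^ Suc DIM('a)) \<partial>lborel) =
      ennreal (sphere_area TYPE('a)) * (\<integral>\<^sup>+t. ennreal (indicator {0<..} t * t ^ k * (e / max t D ^ Suc (Suc k))) \<partial>lborel)"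
    using D e unfolding sphere_area_def by (subst nn_integral_norm) (auto simp: n)
  also have "\<dots> \<le> ennreal (sphere_area TYPE('a)) * ennreal (2 * e / D)"
    by (intro mult_left_mono *) auto
  also have "\<dots> = ennreal (sphere_area TYPE('a) * (2 * e / D))"
    by (rule ennreal_mult'[symmetric]) (rule sphere_area_nonneg)
  finally show ?thesis .
qed

lemma integrable_integral_bound:
  fixes f :: "'a::euclidean_space \<Rightarrow> real"
  assumes [measurable]: "f \<in> borel_measurable borel"
    and bound: "(\<integral>\<^sup>+z. ennreal \<bar>f z\<bar> \<partial>lborel) \<le> ennreal X" and X: "0 \<le> X"
  shows "integrable lborel f" "\<bar>\<integral>z. f z \<partial>lborel\<bar> \<le> X"
proof -
  show int: "integrable lborel f"
    using bound by (intro integrableI_bounded) (auto simp: le_less_trans[OF _ ennreal_less_top])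
  have "ennreal \<bar>\<integral>z. f z \<partial>lborel\<bar> \<le> ennreal X"
    using integral_norm_bound_ennreal[OF int] bound by (simp add: order_trans)
  then show "\<bar>\<integral>z. f z \<partial>lborel\<bar> \<le> X"
    using X by simp
qed

context singular_kernel
begin

text \<open>A single \<open>reg_kernel\<close> decays like |z|^(-n) and is in general not absolutely
  integrable. The difference of two is a radial profile supported in |z| <= D times
  \<open>s\<close>, so \<open>radial_mean_zero\<close> applies.\<close>

lemma reg_kernel_diff_mean_zero:
  assumes "0 < h" "h \<le> D"
  shows "integrable lborel (\<lambda>z. reg_kernel h z - reg_kernel D z)"
    "(\<integral>z. reg_kernel h z - reg_kernel D z \<partial>lborel) = 0"
proof -
  \<comment> \<open>The value 0 for t <= 0 secures the sign condition that
    \<open>radial_mean_zero\<close> asks for at every real argument.\<close>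
  define g where "g t = (if 0 < t then t / max t h ^ Suc DIM('a) - t / max t D ^ Suc DIM('a) else 0)" for t
  have [measurable]: "g \<in> borel_measurable borel" unfolding g_def[abs_def] by measurable
  have eq: "reg_kernel h z - reg_kernel D z = g (norm z) * s z" for z
    by (auto simp: reg_kernel_def g_def algebra_simps)
  have g0: "0 \<le> g t" for t
  proof -
    have "t / max t D ^ Suc DIM('a) \<le> t / max t h ^ Suc DIM('a)" if "0 < t"
      using assms that by (intro divide_left_mono power_mono mult_pos_pos zero_less_power) auto
    then show ?thesis by (simp add: g_def)
  qed
  have gB: "g t \<le> 1 / h ^ DIM('a)" for t
  proof (cases "0 < t")
    case True
    have "g t \<le> t / max t h ^ Suc DIM('a)"
      using True assms by (simp add: g_def)
    also have "\<dots> \<le> max t h / max t h ^ Suc DIM('a)"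
      using True by (intro divide_right_mono) auto
    also have "\<dots> = 1 / max t h ^ DIM('a)"
      using assms by simp
    also have "\<dots> \<le> 1 / h ^ DIM('a)"
      using assms by (intro divide_left_mono power_mono) auto
    finally show ?thesis .
  qed (use assms in \<open>simp add: g_def\<close>)
  have supp: "g t = 0" if "D < t" for t
    using that assms by (simp add: g_def)
  show "integrable lborel (\<lambda>z. reg_kernel h z - reg_kernel D z)"
    "(\<integral>z. reg_kernel h z - reg_kernel D z \<partial>lborel) = 0"
    unfolding eq by (intro radial_mean_zero[where B = "1 / h ^ DIM('a)" and D = D]; simp add: g0 gB supp)+
qed

text \<open>The roles of \<open>norm d\<close> and \<open>h\<close> are kept apart: for a fixed
  shift the bound decays as \<open>h\<close> grows, and the vanishing of the integral rests on
  this.\<close>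

lemma reg_kernel_increment_integral:
  assumes h: "0 < h" and d: "norm d \<le> h"
  shows "integrable lborel (\<lambda>z. reg_kernel h z - reg_kernel h (z + d))"
    "\<bar>\<integral>z. reg_kernel h z - reg_kernel h (z + d) \<partial>lborel\<bar> \<le>
      sphere_area TYPE('a) * (2 * (lip_const TYPE('a) * M * norm d) / h)"
proof -
  have "(\<integral>\<^sup>+z. ennreal \<bar>reg_kernel h z - reg_kernel h (z + d)\<bar> \<partial>lborel) \<le>
      (\<integral>\<^sup>+z. ennreal (lip_const TYPE('a) * M * norm d / max (norm (z::'a)) h ^ Suc DIM('a)) \<partial>lborel)"
    by (rule nn_integral_mono, rule ennreal_leI, rule reg_kernel_lipschitz) (use assms in auto)
  also have "\<dots> \<le> ennreal (sphere_area TYPE('a) * (2 * (lip_const TYPE('a) * M * norm d) / h))"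
    using h M_nonneg lip_const_pos[where 'a='a] by (intro nn_integral_inverse_max_power) auto
  finally have *: "(\<integral>\<^sup>+z. ennreal \<bar>reg_kernel h z - reg_kernel h (z + d)\<bar> \<partial>lborel) \<le>
    ennreal (sphere_area TYPE('a) * (2 * (lip_const TYPE('a) * M * norm d) / h))" .
  show "integrable lborel (\<lambda>z. reg_kernel h z - reg_kernel h (z + d))"
    "\<bar>\<integral>z. reg_kernel h z - reg_kernel h (z + d) \<partial>lborel\<bar> \<le>
      sphere_area TYPE('a) * (2 * (lip_const TYPE('a) * M * norm d) / h)"
    using h M_nonneg lip_const_pos[where 'a='a] sphere_area_nonneg[where 'a='a]
    by (intro integrable_integral_bound[OF _ *]; simp)+
qed

text \<open>The integral of the increment does not depend on \<open>h\<close>, and it tends to 0 as \<open>h\<close> grows.\<close>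

lemma reg_kernel_increment_mean_zero:
  assumes h: "0 < h" and d: "norm d \<le> h"
  shows "(\<integral>z. reg_kernel h z - reg_kernel h (z + d) \<partial>lborel) = 0"
proof -
  define I where "I = (\<lambda>h. \<integral>z. reg_kernel h z - reg_kernel h (z + d) \<partial>lborel)"
  define c where "c = sphere_area TYPE('a) * (2 * (lip_const TYPE('a) * M * norm d))"
  \<comment> \<open>Replacing \<open>h\<close> by \<open>D\<close> changes the integrand by
    \<open>?G z - ?G (z + d)\<close>, where both terms are integrable with integral 0.\<close>
  have eq: "I h = I D" if "h \<le> D" for D
  proof -
    let ?G = "\<lambda>z. reg_kernel h z - reg_kernel D z"
    have G: "integrable lborel ?G" "integrable lborel (\<lambda>z. ?G (z + d))"
      "(\<integral>z. ?G z \<partial>lborel) = 0" "(\<integral>z. ?G (z + d) \<partial>lborel) = 0"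
      using reg_kernel_diff_mean_zero[OF h that]
        integrable_lborel_translate[where f = ?G and d = d] integral_lborel_translate[where f = ?G and d = d]
      by auto
    have "I h = (\<integral>z. (?G z - ?G (z + d)) + (reg_kernel D z - reg_kernel D (z + d)) \<partial>lborel)"
      unfolding I_def by (intro Bochner_Integration.integral_cong) auto
    also have "\<dots> = (\<integral>z. ?G z - ?G (z + d) \<partial>lborel) + I D"
      unfolding I_def
      by (rule Bochner_Integration.integral_add[OF Bochner_Integration.integrable_diff[OF G(1,2)]
            reg_kernel_increment_integral(1)]) (use h d that in auto)
    also have "(\<integral>z. ?G z - ?G (z + d) \<partial>lborel) = 0"
      using Bochner_Integration.integral_diff[OF G(1,2)] G(3,4) by simp
    finally show ?thesis by simp
  qed
  have "\<bar>I h\<bar> \<le> c / D" if "h \<le> D" for D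
    unfolding eq[OF that] unfolding I_def c_def using reg_kernel_increment_integral(2)[of D d] h d that by simp
  then have "eventually (\<lambda>D. \<bar>I h\<bar> \<le> c / D) at_top"
    by (rule eventually_at_top_linorderI)
  moreover have "((\<lambda>D. c / D) \<longlongrightarrow> 0) at_top"
    by (intro tendsto_divide_0[OF tendsto_const] filterlim_at_top_imp_at_infinity filterlim_ident)
  ultimately have "\<bar>I h\<bar> \<le> 0"
    by (intro tendsto_lowerbound[of "\<lambda>D. c / D" 0 at_top]) auto
  then show ?thesis by (simp add: I_def)
qed

end

section \<open>Dini moduli\<close>

definition hat :: "(real \<Rightarrow> real) \<Rightarrow> real \<Rightarrow> real" where
  "hat w r = integral {0..r} (\<lambda>s. w s / s)"

locale dini_modulus =
  fixes w :: "real \<Rightarrow> real" and R :: real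
  assumes osc: "oscillation_function w R"
    and dini: "(\<lambda>r. w r / r) integrable_on {0<..<R}"
begin

lemma R_pos: "0 < R" and w_zero: "w 0 = 0"
  and w_pos: "0 < r \<Longrightarrow> r < R \<Longrightarrow> 0 < w r"
  and w_mono: "0 \<le> r \<Longrightarrow> r \<le> r' \<Longrightarrow> r' < R \<Longrightarrow> w r \<le> w r'"
  using osc by (auto simp: oscillation_function_def mono_on_def)

lemma w_nonneg: "0 \<le> r \<Longrightarrow> r < R \<Longrightarrow> 0 \<le> w r"
  using w_pos[of r] w_zero by (cases "r = 0") auto

text \<open>Nothing is known of \<open>w\<close> outside \<open>{0..<R}\<close>, so it is measurable
  only after a cutoff; later integrands carry this indicator for that reason.\<close>

lemma w_measurable [measurable]: "(\<lambda>s. indicator {0<..<R} s * w s) \<in> borel_measurable borel"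
proof -
  have "continuous_on {0<..<R} w"
    using osc by (auto simp: oscillation_function_def intro: continuous_on_subset)
  then show ?thesis
    using borel_measurable_continuous_on_indicator[of "{0<..<R}" w] by simp
qed

lemma w_indicator_measurable:
  assumes [measurable]: "A \<in> sets borel" and A: "A \<subseteq> {0<..<R}"
  shows "(\<lambda>s. indicator A s * w s) \<in> borel_measurable borel"
proof -
  have "(\<lambda>s. indicator A s * w s) = (\<lambda>s. indicator A s * (indicator {0<..<R} s * w s))"
    using A by (auto simp: indicator_def fun_eq_iff)
  then show ?thesis by simp
qed

lemma dini_integrable: "integrable lborel (\<lambda>s. indicator {0<..<R} s * w s / s)"
proof (rule integrableI_nonneg)
  have "(\<integral>\<^sup>+s. ennreal (indicator {0<..<R} s * (w s / s)) \<partial>lborel) = ennreal (integral {0<..<R} (\<lambda>s. w s / s))"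
    using integrable_integral[OF dini] by (intro nn_integral_has_integral_lebesgue) (auto intro!: divide_nonneg_nonneg w_nonneg)
  then show "(\<integral>\<^sup>+s. ennreal (indicator {0<..<R} s * w s / s) \<partial>lborel) < \<infinity>"
    by simp
  show "(\<lambda>s. indicator {0<..<R} s * w s / s) \<in> borel_measurable lborel"
    by measurable
  show "AE s in lborel. 0 \<le> indicator {0<..<R} s * w s / s"
    by (rule AE_I2) (auto simp: indicator_def intro!: divide_nonneg_nonneg w_nonneg)
qed

lemma hat_nonneg: "0 \<le> h \<Longrightarrow> h < R \<Longrightarrow> 0 \<le> hat w h"
  unfolding hat_def
  by (cases "(\<lambda>s. w s / s) integrable_on {0..h}")
     (auto intro!: integral_nonneg divide_nonneg_nonneg w_nonneg simp: not_integrable_integral)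

lemma hat_integrable: "h < R \<Longrightarrow> (\<lambda>s. w s / s) integrable_on {0..h}"
proof -
  assume "h < R"
  have "(\<lambda>s. w s / s) integrable_on {0..R}"
    using dini by (simp add: integrable_on_Icc_iff_Ioo)
  then show ?thesis
    by (rule integrable_on_subinterval) (use \<open>h < R\<close> in auto)
qed

lemma hat_mono: "0 \<le> r \<Longrightarrow> r \<le> r' \<Longrightarrow> r' < R \<Longrightarrow> hat w r \<le> hat w r'"
  unfolding hat_def
  by (intro integral_subset_le hat_integrable) (auto intro!: divide_nonneg_nonneg w_nonneg)

lemma nn_integral_hat:
  assumes "0 \<le> h" "h < R"
  shows "(\<integral>\<^sup>+s. ennreal (indicator {0<..<h} s * w s / s) \<partial>lborel) \<le> ennreal (hat w h)"
proof -
  have "(\<integral>\<^sup>+s. ennreal (indicator {0<..<h} s * w s / s) \<partial>lborel) \<le>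
      (\<integral>\<^sup>+s. ennreal (indicator {0..h} s * (w s / s)) \<partial>lborel)"
    using assms by (intro nn_integral_mono ennreal_leI) (auto simp: indicator_def intro!: divide_nonneg_nonneg w_nonneg)
  also have "\<dots> = ennreal (hat w h)"
    unfolding hat_def using assms integrable_integral[OF hat_integrable[of h]]
    by (intro nn_integral_has_integral_lebesgue) (auto intro!: divide_nonneg_nonneg w_nonneg)
  finally show ?thesis .
qed

text \<open>The form in which condition (b) is used: it allows terms linear in \<open>h\<close> to
  be absorbed into \<open>hat w h\<close>.\<close>

lemma hat_ge:
  assumes "0 \<le> h" "h < R" and le: "\<And>s. 0 < s \<Longrightarrow> s \<le> h \<Longrightarrow> 1 \<le> w s / s"
  shows "h \<le> hat w h"
proof -
  \<comment> \<open>The open interval avoids s = 0, where \<open>w 0 / 0\<close> is 0.\<close>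
  have "integral {0<..<h} (\<lambda>s. 1) \<le> integral {0<..<h} (\<lambda>s. w s / s)"
    using assms hat_integrable[of h]
    by (intro integral_le) (auto simp: integrable_on_Icc_iff_Ioo[symmetric])
  then show ?thesis
    using assms by (simp add: hat_def integral_open_interval_real[symmetric])
qed

lemma hat_tendsto_0: "(hat w \<longlongrightarrow> 0) (at_right 0)"
proof -
  define b where "b = R / 2"
  have b: "0 < b" "b < R" using R_pos by (auto simp: b_def)
  have "continuous_on {0..b} (hat w)"
    unfolding hat_def[abs_def] by (intro indefinite_integral_continuous_1 hat_integrable b)
  then have "(hat w \<longlongrightarrow> hat w 0) (at 0 within {0..b})"
    using b by (auto simp: continuous_on_def)
  then have "(hat w \<longlongrightarrow> hat w 0) (at_right 0)"
    using b by (simp add: at_within_Icc_at_right)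
  then show ?thesis by (simp add: hat_def)
qed

text \<open>On \<open>{h..<R}\<close> the weight 1/s^2 is at most 1/(h s), so the Dini condition
  gives convergence. This guarantees that the integral in condition (d) is a true value and not the
  default 0 of a divergent integral.\<close>

lemma nn_integral_tail:
  assumes h: "0 < h"
  shows "(\<integral>\<^sup>+s. ennreal (indicator {h..<R} s * w s / s\<^sup>2) \<partial>lborel) = ennreal (integral {h..<R} (\<lambda>s. w s / s\<^sup>2))"
    and "0 \<le> integral {h..<R} (\<lambda>s. w s / s\<^sup>2)"
proof -
  have eq: "indicator {h..<R} s * (w s / s\<^sup>2) = indicator {h..<R} s * (indicator {0<..<R} s * w s) / s\<^sup>2" for s
    using h by (auto simp: indicator_def)
  have "integrable lborel (\<lambda>s. indicator {h..<R} s * (w s / s\<^sup>2))"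
  proof (rule Bochner_Integration.integrable_bound)
    show "integrable lborel (\<lambda>s. (indicator {0<..<R} s * w s / s) / h)"
      by (intro integrable_divide dini_integrable)
    show "(\<lambda>s. indicator {h..<R} s * (w s / s\<^sup>2)) \<in> borel_measurable lborel"
      unfolding eq by measurable
    show "AE s in lborel. norm (indicator {h..<R} s * (w s / s\<^sup>2)) \<le> norm ((indicator {0<..<R} s * w s / s) / h)"
    proof (rule AE_I2)
      fix s
      show "norm (indicator {h..<R} s * (w s / s\<^sup>2)) \<le> norm ((indicator {0<..<R} s * w s / s) / h)"
      proof (cases "s \<in> {h..<R}")
        case True
        then have "w s / (s * s) \<le> w s / (s * h)"
          using h by (intro divide_left_mono mult_left_mono w_nonneg mult_pos_pos) auto
        then show ?thesis
          using True h w_nonneg[of s] by (simp add: power2_eq_square)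
      qed simp
    qed
  qed
  from has_integral_lborel_indicator[OF this]
  have I: "((\<lambda>s. w s / s\<^sup>2) has_integral integral {h..<R} (\<lambda>s. w s / s\<^sup>2)) {h..<R}"
    by (simp add: has_integral_integrable integrable_integral)
  have nn: "0 \<le> w s / s\<^sup>2" if "s \<in> {h..<R}" for s
    using that h by (auto intro!: divide_nonneg_nonneg w_nonneg)
  show "0 \<le> integral {h..<R} (\<lambda>s. w s / s\<^sup>2)"
    by (rule has_integral_nonneg[OF I nn])
  show "(\<integral>\<^sup>+s. ennreal (indicator {h..<R} s * w s / s\<^sup>2) \<partial>lborel) = ennreal (integral {h..<R} (\<lambda>s. w s / s\<^sup>2))"
    using nn_integral_has_integral_lebesgue[OF nn I] by simp
qed

end

section \<open>The singular integral\<close>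

text \<open>\<open>L\<close> and \<open>B\<close> stand for the seminorm and the supremum of
  \<open>phi\<close>. The modulus is assumed on the whole space, which \<open>zero_extension\<close>
  provides. The radius \<open>rho\<close> ensures convergence at infinity and does not enter the
  bounds.\<close>

locale singular_integral = singular_kernel s M + dini_modulus w R
  for s :: "'a::euclidean_space \<Rightarrow> real" and M w R +
  fixes phi :: "'a \<Rightarrow> real" and rho L B :: real
  assumes phi_measurable [measurable]: "phi \<in> borel_measurable borel"
    and phi_support: "\<And>y. rho \<le> norm y \<Longrightarrow> phi y = 0"
    and phi_bound: "\<And>y. \<bar>phi y\<bar> \<le> B"
    and phi_modulus: "\<And>x y. 0 < norm (x - y) \<Longrightarrow> norm (x - y) < R \<Longrightarrow> \<bar>phi x - phi y\<bar> \<le> L * w (norm (x - y))"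
    and L_nonneg: "0 \<le> L"
begin

lemma B_nonneg: "0 \<le> B"
  using phi_bound[of 0] by linarith

text \<open>At distances of at least \<open>R\<close>, where \<open>w\<close> gives no control, the
  trivial bound \<open>2 * B\<close> takes over.\<close>

definition modulus :: "real \<Rightarrow> real" where
  "modulus t = L * (indicator {0<..<R} t * w t) + 2 * B * indicator {R..} t"

lemma modulus_measurable [measurable]: "modulus \<in> borel_measurable borel"
  unfolding modulus_def[abs_def] by measurable

lemma modulus_nonneg: "0 \<le> modulus t"
  using L_nonneg B_nonneg w_nonneg[of t] by (auto simp: modulus_def indicator_def)

lemma phi_diff: "\<bar>phi (x - z) - phi x\<bar> \<le> modulus (norm z)"
proof -
  consider "z = 0" | "0 < norm z" "norm z < R" | "R \<le> norm z" by fastforce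
  then show ?thesis
  proof cases
    case 2
    then show ?thesis using phi_modulus[of "x - z" x] by (simp add: modulus_def)
  next
    case 3
    then show ?thesis
      using phi_bound[of "x - z"] phi_bound[of x] R_pos by (simp add: modulus_def)
  qed (simp add: modulus_nonneg)
qed

text \<open>Subtracting \<open>phi x\<close> makes the singular part absolutely integrable; the
  subtracted term has integral zero over every set |z| >= e.\<close>

definition near :: "real \<Rightarrow> 'a \<Rightarrow> 'a \<Rightarrow> real" where
  "near h x z = gap h (norm z) * s z * (phi (x - z) - phi x)"

definition far :: "real \<Rightarrow> 'a \<Rightarrow> 'a \<Rightarrow> real" where
  "far h x z = reg_kernel h z * phi (x - z)"

lemma near_measurable [measurable]: "near h x \<in> borel_measurable borel"
  and far_measurable [measurable]: "far h x \<in> borel_measurable borel"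
  unfolding near_def[abs_def] far_def[abs_def] by measurable

text \<open>The profile \<open>gap\<close> is at most t^(-n), which the Jacobian t^(n-1) turns into
  1/t; what remains is the Dini integral of \<open>w\<close> over (0, h).\<close>

lemma near_integral:
  assumes h: "0 < h" "h < R"
  shows "integrable lborel (near h x)"
    "\<bar>\<integral>z. near h x z \<partial>lborel\<bar> \<le> sphere_area TYPE('a) * (M * L * hat w h)"
proof -
  define k where "k = DIM('a) - 1"
  have n: "DIM('a) = Suc k" by (simp add: k_def)
  define g where "g t = M * L * (indicator {0<..<h} t * (indicator {0<..<R} t * w t)) / t ^ DIM('a)" for t
  have [measurable]: "g \<in> borel_measurable borel" unfolding g_def[abs_def] by measurable
  have g0: "0 \<le> g t" for t
    using M_nonneg L_nonneg h by (auto simp: g_def indicator_def intro!: divide_nonneg_nonneg mult_nonneg_nonneg w_nonneg)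
  have near_le: "\<bar>near h x z\<bar> \<le> g (norm z)" for z
  proof (cases "0 < norm z \<and> norm z < h")
    case True
    have "\<bar>near h x z\<bar> = gap h (norm z) * \<bar>s z\<bar> * \<bar>phi (x - z) - phi x\<bar>"
      by (simp add: near_def abs_mult gap_nonneg)
    also have "\<dots> \<le> indicator {0<..<h} (norm z) / norm z ^ DIM('a) * M * modulus (norm z)"
      using M_nonneg by (intro mult_mono gap_le s_bound phi_diff) (auto simp: gap_nonneg)
    also have "\<dots> = g (norm z)"
      using True h by (simp add: g_def modulus_def)
    finally show ?thesis .
  qed (auto simp: near_def gap_def g0)
  have g_eq: "indicator {0<..} t * t ^ k * g t = M * L * (indicator {0<..<h} t * w t / t)" for t
    using h by (auto simp: g_def n indicator_def)
  have [measurable]: "(\<lambda>s. indicator {0<..<h} s * w s) \<in> borel_measurable borel"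
    using h by (intro w_indicator_measurable) auto
  have "(\<integral>\<^sup>+z. ennreal \<bar>near h x z\<bar> \<partial>lborel) \<le> (\<integral>\<^sup>+z. ennreal (g (norm (z::'a))) \<partial>lborel)"
    by (intro nn_integral_mono ennreal_leI near_le)
  also have "\<dots> = ennreal (sphere_area TYPE('a)) * (\<integral>\<^sup>+t. ennreal (M * L * (indicator {0<..<h} t * w t / t)) \<partial>lborel)"
    unfolding g_eq[symmetric] sphere_area_def by (subst nn_integral_norm) (auto simp: g0 k_def)
  also have "(\<integral>\<^sup>+t. ennreal (M * L * (indicator {0<..<h} t * w t / t)) \<partial>lborel) =
      ennreal (M * L) * (\<integral>\<^sup>+t. ennreal (indicator {0<..<h} t * w t / t) \<partial>lborel)"
    unfolding ennreal_mult'[OF mult_nonneg_nonneg[OF M_nonneg L_nonneg]] by (intro nn_integral_cmult) measurable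
  also have "ennreal (sphere_area TYPE('a)) * \<dots> \<le> ennreal (sphere_area TYPE('a)) * (ennreal (M * L) * ennreal (hat w h))"
    using h by (intro mult_left_mono nn_integral_hat) auto
  also have "\<dots> = ennreal (sphere_area TYPE('a) * (M * L * hat w h))"
    using M_nonneg L_nonneg sphere_area_nonneg[where 'a='a] by (simp add: ennreal_mult' mult.assoc)
  finally have *: "(\<integral>\<^sup>+z. ennreal \<bar>near h x z\<bar> \<partial>lborel) \<le> ennreal (sphere_area TYPE('a) * (M * L * hat w h))" .
  show "integrable lborel (near h x)"
    "\<bar>\<integral>z. near h x z \<partial>lborel\<bar> \<le> sphere_area TYPE('a) * (M * L * hat w h)"
    using M_nonneg L_nonneg sphere_area_nonneg[where 'a='a] h hat_nonneg[of h]
    by (intro integrable_integral_bound[OF _ *]; simp)+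
qed

lemma far_integrable:
  assumes h: "0 < h"
  shows "integrable lborel (far h x)"
proof (rule integrable_lborel_bounded_support)
  show "\<bar>far h x z\<bar> \<le> M / h ^ DIM('a) * B" for z
    unfolding far_def abs_mult using M_nonneg h by (intro mult_mono reg_kernel_bound phi_bound) auto
  show "far h x z = 0" if "norm x + rho < norm z" for z
  proof -
    have "rho \<le> norm (x - z)"
      using norm_triangle_ineq2[of z x] that by (simp add: norm_minus_commute)
    then show ?thesis by (simp add: far_def phi_support)
  qed
qed simp

text \<open>The principal value as an absolutely convergent integral. The splitting radius stays a
  parameter so that it can be set to the distance of the two points being compared.\<close>

definition potential :: "real \<Rightarrow> 'a \<Rightarrow> real" where
  "potential h x = (\<integral>z. near h x z + far h x z \<partial>lborel)"

lemma pv_integrable: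
  assumes e: "0 < e"
  shows "integrable lborel (\<lambda>z. indicator {z. e \<le> norm z} z * (kernel s z * phi (x - z)))"
proof (rule integrable_lborel_bounded_support)
  have [measurable]: "Measurable.pred borel (\<lambda>z::'a. e \<le> norm z)" by measurable
  show "(\<lambda>z. indicator {z. e \<le> norm z} z * (kernel s z * phi (x - z))) \<in> borel_measurable borel"
    by measurable
  show "\<bar>indicator {z. e \<le> norm z} z * (kernel s z * phi (x - z))\<bar> \<le> M / e ^ DIM('a) * B" for z
  proof (cases "e \<le> norm z")
    case True
    have "\<bar>kernel s z\<bar> \<le> M / e ^ DIM('a)"
      by (rule order_trans[OF kernel_bound])
        (use True e M_nonneg in \<open>auto intro!: divide_left_mono power_mono mult_pos_pos zero_less_power\<close>)
    then have "\<bar>kernel s z\<bar> * \<bar>phi (x - z)\<bar> \<le> M / e ^ DIM('a) * B"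
      using e M_nonneg by (intro mult_mono phi_bound) auto
    then show ?thesis using True by (simp add: abs_mult)
  qed (use e M_nonneg B_nonneg in simp)
  show "indicator {z. e \<le> norm z} z * (kernel s z * phi (x - z)) = 0" if "norm x + rho < norm z" for z
  proof -
    have "rho \<le> norm (x - z)"
      using norm_triangle_ineq2[of z x] that by (simp add: norm_minus_commute)
    then show ?thesis by (simp add: phi_support)
  qed
qed

text \<open>Cut off below \<open>e\<close>, the profile \<open>gap h\<close> is bounded with bounded
  support, so its product with \<open>s\<close> has integral zero and \<open>phi x\<close> may be
  subtracted at no cost.\<close>

lemma truncated_integral:
  assumes e: "0 < e" and h: "0 < h" "h < R"
  shows "(\<integral>z. indicator {z. e \<le> norm z} z * (kernel s z * phi (x - z)) \<partial>lborel) =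
    (\<integral>z. indicator {z. e \<le> norm z} z * (near h x z + far h x z) \<partial>lborel)"
proof -
  define g where "g t = indicator {e..} t * gap h t" for t
  have [measurable]: "g \<in> borel_measurable borel" unfolding g_def[abs_def] by measurable
  have [measurable]: "Measurable.pred borel (\<lambda>z::'a. e \<le> norm z)" by measurable
  have gB: "g t \<le> 1 / e ^ DIM('a)" for t
  proof (cases "e \<le> t")
    case True
    have "gap h t \<le> 1 / t ^ DIM('a)"
      by (rule order_trans[OF gap_le]) (use True e in \<open>auto simp: indicator_def\<close>)
    also have "\<dots> \<le> 1 / e ^ DIM('a)"
      using True e by (auto intro!: divide_left_mono power_mono)
    finally show ?thesis using True by (simp add: g_def)
  qed (use e in \<open>simp add: g_def\<close>)
  have g0: "0 \<le> g t" and g_supp: "h < t \<Longrightarrow> g t = 0" for t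
    by (simp_all add: g_def gap_nonneg) (simp add: gap_def)
  have g: "integrable lborel (\<lambda>z. g (norm z) * s z)" "(\<integral>z. g (norm z) * s z \<partial>lborel) = 0"
    by (rule radial_mean_zero[where B = "1 / e ^ DIM('a)" and D = h]; simp add: gB g0 g_supp)+
  have int: "integrable lborel (\<lambda>z. indicator {z. e \<le> norm z} z * (near h x z + far h x z))"
  proof (rule Bochner_Integration.integrable_bound)
    show "integrable lborel (\<lambda>z. near h x z + far h x z)"
      using h near_integral(1) far_integrable by auto
  qed (auto simp: indicator_def)
  have "(\<integral>z. indicator {z. e \<le> norm z} z * (kernel s z * phi (x - z)) \<partial>lborel) =
      (\<integral>z. indicator {z. e \<le> norm z} z * (near h x z + far h x z) + phi x * (g (norm z) * s z) \<partial>lborel)"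
    by (intro Bochner_Integration.integral_cong)
       (auto simp: indicator_def g_def kernel_split[of _ h] near_def far_def algebra_simps)
  also have "\<dots> = (\<integral>z. indicator {z. e \<le> norm z} z * (near h x z + far h x z) \<partial>lborel) +
      (\<integral>z. phi x * (g (norm z) * s z) \<partial>lborel)"
    using g by (intro Bochner_Integration.integral_add int) auto
  finally show ?thesis using g by simp
qed

text \<open>The substitution z = x - y and \<open>truncated_integral\<close> give an integrand
  dominated by the integrable \<open>near + far\<close>, so dominated convergence applies along
  every sequence of radii tending to 0.\<close>

lemma pv_potential:
  assumes h: "0 < h" "h < R"
  shows "pv_conv_at s phi x (potential h x)"
  unfolding pv_conv_at_def
proof
  let ?F = "\<lambda>e y. indicator {y. e \<le> norm (x - y)} y * (kernel s (x - y) * phi y)"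
  have F_int: "integrable lborel (?F e)" if "0 < e" for e
    using integrable_lborel_reflect_iff[of "\<lambda>z. indicator {z. e \<le> norm z} z * (kernel s z * phi (x - z))" x]
      pv_integrable[OF that, of x]
    by (simp add: indicator_def)
  have hi: "((\<lambda>y. kernel s (x - y) * phi y) has_integral
      (\<integral>z. indicator {z. e \<le> norm z} z * (near h x z + far h x z) \<partial>lborel)) {y. e \<le> norm (x - y)}"
    if e: "0 < e" for e
  proof -
    have "(\<integral>y. ?F e y \<partial>lborel) =
        (\<integral>z. indicator {z. e \<le> norm z} z * (kernel s z * phi (x - z)) \<partial>lborel)"
      using integral_lborel_reflect[of "\<lambda>z. indicator {z. e \<le> norm z} z * (kernel s z * phi (x - z))" x]
      by (simp add: indicator_def)
    with has_integral_lborel_indicator[OF F_int[OF e]] show ?thesis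
      by (simp add: truncated_integral[OF e h])
  qed
  then show "\<forall>e>0. (\<lambda>y. kernel s (x - y) * phi y) integrable_on {y. e \<le> norm (x - y)}"
    by (blast intro: has_integral_integrable)
  let ?G = "\<lambda>e z. indicator {z. e \<le> norm z} z * (near h x z + far h x z)"
  have "((\<lambda>e. \<integral>z. ?G e z \<partial>lborel) \<longlongrightarrow> potential h x) (at_right 0)"
    unfolding potential_def
  proof (rule tendsto_at_right_sequentially[of 0 1])
    fix S :: "nat \<Rightarrow> real"
    assume S: "\<And>n. 0 < S n" "S \<longlonglongrightarrow> 0"
    show "(\<lambda>n. \<integral>z. ?G (S n) z \<partial>lborel) \<longlonglongrightarrow> (\<integral>z. near h x z + far h x z \<partial>lborel)"
    proof (rule integral_dominated_convergence)
      show "integrable lborel (\<lambda>z. norm (near h x z + far h x z))"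
        using h near_integral(1) far_integrable by auto
      show "?G (S n) \<in> borel_measurable lborel" for n
      proof -
        have [measurable]: "Measurable.pred borel (\<lambda>z::'a. S n \<le> norm z)" by measurable
        show ?thesis by measurable
      qed
      show "AE z in lborel. (\<lambda>n. ?G (S n) z) \<longlonglongrightarrow> near h x z + far h x z"
      proof (rule AE_I2)
        fix z
        show "(\<lambda>n. ?G (S n) z) \<longlonglongrightarrow> near h x z + far h x z"
        proof (cases "z = 0")
          case True
          then show ?thesis by (simp add: near_def far_def gap_def reg_kernel_def)
        next
          case False
          then have "eventually (\<lambda>n. S n < norm z) sequentially"
            using order_tendstoD(2)[OF S(2)] by simp
          then have "eventually (\<lambda>n. ?G (S n) z = near h x z + far h x z) sequentially"
            by eventually_elim simp
          then show ?thesis by (rule tendsto_eventually)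
        qed
      qed
    qed (auto simp: indicator_def)
  qed simp
  moreover have "eventually (\<lambda>e. (\<integral>z. ?G e z \<partial>lborel) =
      integral {y. e \<le> norm (x - y)} (\<lambda>y. kernel s (x - y) * phi y)) (at_right 0)"
    using hi by (auto simp: eventually_at_right_less intro!: eventually_at_rightI[of 0 1] integral_unique[symmetric])
  ultimately show "((\<lambda>e. integral {y. e \<le> norm (x - y)} (\<lambda>y. kernel s (x - y) * phi y)) \<longlongrightarrow> potential h x) (at_right 0)"
    by (rule Lim_transform_eventually)
qed

text \<open>Both sides are the same principal value, and limits are unique.\<close>

lemma potential_eq:
  assumes "0 < h" "h < R" "0 < h'" "h' < R"
  shows "potential h x = potential h' x"
  using pv_potential[OF assms(1,2), of x] pv_potential[OF assms(3,4), of x]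
  unfolding pv_conv_at_def by (blast intro: tendsto_unique[OF trivial_limit_at_right_real])

text \<open>Shifting the second integral by \<open>d\<close> gives both integrands the factor
  \<open>phi (x - z)\<close>. The kernel increment has integral zero, so \<open>phi x\<close> may be
  subtracted, and the size of the increment meets the modulus of \<open>phi\<close> in one radial
  integral.\<close>

lemma increment_integral:
  assumes d: "0 < norm d" "norm d < R"
  defines "h \<equiv> norm d"
  shows "\<bar>\<integral>z. far h x z - far h (x + d) z \<partial>lborel\<bar> \<le>
    sphere_area TYPE('a) * (lip_const TYPE('a) * M * (L * hat w h + h * L * integral {h..<R} (\<lambda>s. w s / s\<^sup>2) + 2 * B * h / R))"
proof -
  define k where "k = DIM('a) - 1"
  have n: "DIM('a) = Suc k" by (simp add: k_def)
  have h: "0 < h" "h < R" using d by (auto simp: h_def)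
  let ?\<Delta> = "\<lambda>z. reg_kernel h z - reg_kernel h (z + d)"
  let ?T = "integral {h..<R} (\<lambda>s. w s / s\<^sup>2)"
  have \<Delta>: "integrable lborel ?\<Delta>" "(\<integral>z. ?\<Delta> z \<partial>lborel) = 0"
    using h by (auto simp: h_def intro!: reg_kernel_increment_integral reg_kernel_increment_mean_zero)
  define g where "g t = lip_const TYPE('a) * M * (h / max t h ^ Suc DIM('a)) * modulus t" for t
  have [measurable]: "g \<in> borel_measurable borel" unfolding g_def[abs_def] by measurable
  have C0: "0 \<le> lip_const TYPE('a) * M" using lip_const_pos[where 'a='a] M_nonneg by simp
  have g0: "0 \<le> g t" for t
    using C0 h by (auto simp: g_def modulus_nonneg intro!: mult_nonneg_nonneg)
  have le: "\<bar>?\<Delta> z * (phi (x - z) - phi x)\<bar> \<le> g (norm z)" for z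
  proof -
    have "\<bar>?\<Delta> z\<bar> * \<bar>phi (x - z) - phi x\<bar> \<le> lip_const TYPE('a) * M * norm d / max (norm z) h ^ Suc DIM('a) * modulus (norm z)"
      using h C0
      by (intro mult_mono reg_kernel_lipschitz phi_diff divide_nonneg_nonneg mult_nonneg_nonneg zero_le_power)
         (use M_nonneg lip_const_pos[where 'a='a] in \<open>auto simp: h_def le_max_iff_disj\<close>)
    then show ?thesis by (simp add: abs_mult g_def h_def)
  qed
  \<comment> \<open>The three ranges of the radial integral: below \<open>h\<close> with weight 1/t,
    from \<open>h\<close> to \<open>R\<close> with weight h/t^2, and beyond \<open>R\<close>, where
    the modulus is \<open>2 * B\<close>. They yield the three summands of the bound.\<close>
  define a1 where "a1 t = L * (indicator {0<..<h} t * (indicator {0<..<R} t * w t) / t)" for t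
  define a2 where "a2 t = h * L * (indicator {h..<R} t * (indicator {0<..<R} t * w t) / t\<^sup>2)" for t
  define a3 where "a3 t = indicator {R..} t * (2 * B * h / t\<^sup>2)" for t :: real
  have [measurable]: "a1 \<in> borel_measurable borel" "a2 \<in> borel_measurable borel" "a3 \<in> borel_measurable borel"
    unfolding a1_def[abs_def] a2_def[abs_def] a3_def[abs_def] by measurable
  have a1_eq: "a1 t = L * (indicator {0<..<h} t * w t / t)"
    and a2_eq: "a2 t = h * L * (indicator {h..<R} t * w t / t\<^sup>2)" for t
    using h by (auto simp: a1_def a2_def indicator_def)
  have [measurable]: "(\<lambda>t. indicator {0<..<h} t * w t) \<in> borel_measurable borel"
    "(\<lambda>t. indicator {h..<R} t * w t) \<in> borel_measurable borel"
    using h by (auto intro!: w_indicator_measurable)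
  have a0: "0 \<le> a1 t" "0 \<le> a2 t" "0 \<le> a3 t" for t
    using L_nonneg B_nonneg h w_nonneg[of t] by (auto simp: a1_def a2_def a3_def indicator_def)
  have pw: "indicator {0<..} t * t ^ k * g t \<le> lip_const TYPE('a) * M * (a1 t + a2 t + a3 t)" for t
  proof (cases "0 < t")
    case True
    have "t ^ k / max t h ^ Suc DIM('a) \<le> indicator {0<..<h} t / (t * h) + indicator {h..} t / t\<^sup>2"
      unfolding k_def using True h by (intro radial_weight_le) auto
    then have "lip_const TYPE('a) * M * (h * modulus t * (t ^ k / max t h ^ Suc DIM('a))) \<le>
        lip_const TYPE('a) * M * (h * modulus t * (indicator {0<..<h} t / (t * h) + indicator {h..} t / t\<^sup>2))"
      using C0 h modulus_nonneg[of t] by (intro mult_left_mono) auto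
    also have "h * modulus t * (indicator {0<..<h} t / (t * h) + indicator {h..} t / t\<^sup>2) = a1 t + a2 t + a3 t"
      using True h by (auto simp: modulus_def a1_def a2_def a3_def indicator_def field_simps)
    finally show ?thesis using True by (simp add: g_def mult_ac)
  qed (use a0 C0 in simp)
  have I1: "(\<integral>\<^sup>+t. ennreal (a1 t) \<partial>lborel) \<le> ennreal (L * hat w h)"
  proof -
    have "(\<integral>\<^sup>+t. ennreal (a1 t) \<partial>lborel) = ennreal L * (\<integral>\<^sup>+t. ennreal (indicator {0<..<h} t * w t / t) \<partial>lborel)"
      unfolding a1_eq ennreal_mult'[OF L_nonneg] by (intro nn_integral_cmult) measurable
    also have "\<dots> \<le> ennreal L * ennreal (hat w h)"
      using h by (intro mult_left_mono nn_integral_hat) auto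
    finally show ?thesis using L_nonneg by (simp add: ennreal_mult')
  qed
  have I2: "(\<integral>\<^sup>+t. ennreal (a2 t) \<partial>lborel) \<le> ennreal (h * L * ?T)"
  proof -
    have "(\<integral>\<^sup>+t. ennreal (a2 t) \<partial>lborel) = ennreal (h * L) * (\<integral>\<^sup>+t. ennreal (indicator {h..<R} t * w t / t\<^sup>2) \<partial>lborel)"
      unfolding a2_eq ennreal_mult'[OF mult_nonneg_nonneg[OF less_imp_le[OF h(1)] L_nonneg]]
      by (intro nn_integral_cmult) measurable
    then show ?thesis using L_nonneg h by (simp add: ennreal_mult' nn_integral_tail)
  qed
  have I3: "(\<integral>\<^sup>+t. ennreal (a3 t) \<partial>lborel) = ennreal (2 * B * h / R)"
    unfolding a3_def using h B_nonneg R_pos by (intro nn_integral_inverse_square) auto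
  have "(\<integral>\<^sup>+t. ennreal (indicator {0<..} t * t ^ k * g t) \<partial>lborel) \<le>
      (\<integral>\<^sup>+t. ennreal (lip_const TYPE('a) * M) * (ennreal (a1 t) + ennreal (a2 t) + ennreal (a3 t)) \<partial>lborel)"
  proof (rule nn_integral_mono)
    fix t
    have "ennreal (lip_const TYPE('a) * M * (a1 t + a2 t + a3 t)) = ennreal (lip_const TYPE('a) * M) * (ennreal (a1 t) + ennreal (a2 t) + ennreal (a3 t))"
      using C0 a0 by (simp add: ennreal_mult')
    with ennreal_leI[OF pw[of t]] show "ennreal (indicator {0<..} t * t ^ k * g t) \<le>
        ennreal (lip_const TYPE('a) * M) * (ennreal (a1 t) + ennreal (a2 t) + ennreal (a3 t))"
      by simp
  qed
  also have "\<dots> = ennreal (lip_const TYPE('a) * M) * ((\<integral>\<^sup>+t. ennreal (a1 t) \<partial>lborel) + (\<integral>\<^sup>+t. ennreal (a2 t) \<partial>lborel) + (\<integral>\<^sup>+t. ennreal (a3 t) \<partial>lborel))"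
    by (simp add: nn_integral_cmult nn_integral_add)
  also have "\<dots> \<le> ennreal (lip_const TYPE('a) * M) * (ennreal (L * hat w h) + ennreal (h * L * ?T) + ennreal (2 * B * h / R))"
    unfolding I3 by (intro mult_left_mono add_mono I1 I2) auto
  also have "\<dots> = ennreal (lip_const TYPE('a) * M * (L * hat w h + h * L * ?T + 2 * B * h / R))"
    using C0 L_nonneg B_nonneg h R_pos hat_nonneg[of h] nn_integral_tail(2)[of h]
    by (simp add: ennreal_mult')
  finally have rad: "(\<integral>\<^sup>+t. ennreal (indicator {0<..} t * t ^ k * g t) \<partial>lborel) \<le>
     ennreal (lip_const TYPE('a) * M * (L * hat w h + h * L * ?T + 2 * B * h / R))" .
  have "(\<integral>\<^sup>+z. ennreal \<bar>?\<Delta> z * (phi (x - z) - phi x)\<bar> \<partial>lborel) \<le> (\<integral>\<^sup>+z. ennreal (g (norm (z::'a))) \<partial>lborel)"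
    by (intro nn_integral_mono ennreal_leI le)
  also have "\<dots> = ennreal (sphere_area TYPE('a)) * (\<integral>\<^sup>+t. ennreal (indicator {0<..} t * t ^ k * g t) \<partial>lborel)"
    unfolding sphere_area_def k_def by (rule nn_integral_norm) (auto simp: g0)
  also have "\<dots> \<le> ennreal (sphere_area TYPE('a)) * ennreal (lip_const TYPE('a) * M * (L * hat w h + h * L * ?T + 2 * B * h / R))"
    by (intro mult_left_mono rad) auto
  also have "\<dots> = ennreal (sphere_area TYPE('a) * (lip_const TYPE('a) * M * (L * hat w h + h * L * ?T + 2 * B * h / R)))"
    by (rule ennreal_mult'[symmetric]) (rule sphere_area_nonneg)
  finally have "(\<integral>\<^sup>+z. ennreal \<bar>?\<Delta> z * (phi (x - z) - phi x)\<bar> \<partial>lborel) \<le>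
     ennreal (sphere_area TYPE('a) * (lip_const TYPE('a) * M * (L * hat w h + h * L * ?T + 2 * B * h / R)))" .
  note bound = integrable_integral_bound[OF _ this]
  have X0: "0 \<le> sphere_area TYPE('a) * (lip_const TYPE('a) * M * (L * hat w h + h * L * ?T + 2 * B * h / R))"
    using sphere_area_nonneg[where 'a='a] C0 L_nonneg B_nonneg h R_pos hat_nonneg[of h] nn_integral_tail(2)[of h] by simp
  have shift: "integrable lborel (\<lambda>z. far h (x + d) (z + d))"
    "(\<integral>z. far h (x + d) (z + d) \<partial>lborel) = (\<integral>z. far h (x + d) z \<partial>lborel)"
    using far_integrable[of h "x + d"] h by (auto intro: integrable_lborel_translate integral_lborel_translate)
  have "(\<integral>z. far h x z - far h (x + d) z \<partial>lborel) = (\<integral>z. far h x z - far h (x + d) (z + d) \<partial>lborel)"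
    using h far_integrable shift by simp
  also have "\<dots> = (\<integral>z. ?\<Delta> z * (phi (x - z) - phi x) + phi x * ?\<Delta> z \<partial>lborel)"
    by (intro Bochner_Integration.integral_cong) (auto simp: far_def algebra_simps)
  also have "\<dots> = (\<integral>z. ?\<Delta> z * (phi (x - z) - phi x) \<partial>lborel) + (\<integral>z. phi x * ?\<Delta> z \<partial>lborel)"
    by (rule Bochner_Integration.integral_add[OF bound(1) integrable_mult_right[OF \<Delta>(1)]]) (use X0 in auto)
  also have "(\<integral>z. phi x * ?\<Delta> z \<partial>lborel) = 0"
    by (simp only: integral_mult_right_zero \<Delta>(2) mult_zero_right)
  finally show ?thesis using bound(2) X0 by simp
qed

text \<open>By \<open>potential_eq\<close> both values can be computed with splitting radius
  \<open>norm d\<close>. The two \<open>near\<close> integrals are estimated separately, hence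
  \<open>2 * L\<close>; only the \<open>far\<close> integrals need cancellation.\<close>

lemma potential_modulus:
  assumes d: "0 < norm d" "norm d < R" and H: "0 < H" "H < R"
  defines "h \<equiv> norm d"
  shows "\<bar>potential H x - potential H (x + d)\<bar> \<le> sphere_area TYPE('a) * M * (2 * L * hat w h +
    lip_const TYPE('a) * (L * hat w h + h * L * integral {h..<R} (\<lambda>s. w s / s\<^sup>2) + 2 * B * h / R))"
proof -
  have h: "0 < h" "h < R" using d by (auto simp: h_def)
  have p: "potential H y = (\<integral>z. near h y z \<partial>lborel) + (\<integral>z. far h y z \<partial>lborel)" for y
    unfolding potential_eq[OF H h, of y] unfolding potential_def
    using near_integral(1)[OF h] far_integrable[OF h(1)] by (intro Bochner_Integration.integral_add)
  have "(\<integral>z. far h x z - far h (x + d) z \<partial>lborel) = (\<integral>z. far h x z \<partial>lborel) - (\<integral>z. far h (x + d) z \<partial>lborel)"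
    using far_integrable[OF h(1)] by (intro Bochner_Integration.integral_diff)
  then show ?thesis
    using near_integral(2)[OF h, of x] near_integral(2)[OF h, of "x + d"] increment_integral[OF d, of x]
    unfolding p h_def[symmetric] by (simp add: algebra_simps)
qed

end

section \<open>The seminorms\<close>

lemma smooth_on_imp_differentiable:
  fixes f :: "'a::euclidean_space \<Rightarrow> real"
  assumes "smooth_on S f" "open S" "x \<in> S"
  shows "f differentiable at x"
proof -
  have "Ck_on (Suc 0) S f" using assms(1) by (simp only: smooth_on_def)
  then have "f differentiable_on S" by (simp only: Ck_on.simps)
  with assms(2,3) show ?thesis by (simp add: differentiable_on_eq_differentiable_at)
qed

text \<open>Continuity on the compact sphere makes the suprema in \<open>triple_norm\<close> genuine
  upper bounds. A directional derivative is expanded in the basis, each coordinate of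
  \<open>v\<close> being at most \<open>norm v\<close>.\<close>

lemma sigma_le_triple_norm:
  fixes sigma :: "'a::euclidean_space \<Rightarrow> real"
  assumes smooth: "smooth_on (- {0}) sigma" and u: "norm u = 1"
  shows "\<bar>sigma u\<bar> \<le> triple_norm sigma"
    "\<bar>frechet_derivative sigma (at u) v\<bar> \<le> triple_norm sigma * norm v"
proof -
  have Ck: "Ck_on 0 (- {0}) sigma" "Ck_on (Suc 0) (- {0}) sigma"
    using smooth by (auto simp only: smooth_on_def)
  have sph: "sphere 0 1 \<subseteq> - {0::'a}" and u_in: "u \<in> sphere 0 1"
    using u by auto
  have bdd: "bdd_above ((\<lambda>x. \<bar>g x\<bar>) ` sphere 0 1)" if "continuous_on (- {0}) g" for g :: "'a \<Rightarrow> real"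
    using that sph
    by (intro bounded_imp_bdd_above compact_imp_bounded compact_continuous_image continuous_intros
          continuous_on_subset[OF that]) auto
  have up: "\<bar>g u\<bar> \<le> (SUP x\<in>sphere 0 1. \<bar>g x\<bar>)" if "continuous_on (- {0}) g" for g :: "'a \<Rightarrow> real"
    using bdd[OF that] u_in by (intro cSUP_upper) auto
  let ?D = "\<lambda>i. SUP x\<in>sphere 0 1. \<bar>frechet_derivative sigma (at x) i\<bar>"
  have s0: "\<bar>sigma u\<bar> \<le> (SUP x\<in>sphere 0 1. \<bar>sigma x\<bar>)"
    using Ck by (intro up) auto
  have si: "\<bar>frechet_derivative sigma (at u) i\<bar> \<le> ?D i" if "i \<in> Basis" for i
    using Ck that by (intro up) auto
  have D0: "0 \<le> ?D i" if "i \<in> Basis" for i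
    using si[OF that] by linarith
  then have sum0: "0 \<le> (\<Sum>i\<in>Basis. ?D i)"
    by (intro sum_nonneg) auto
  show "\<bar>sigma u\<bar> \<le> triple_norm sigma"
    using s0 sum0 by (simp add: triple_norm_def)
  have "sigma differentiable at u"
    using u by (intro smooth_on_imp_differentiable[OF smooth]) auto
  then have lin: "linear (frechet_derivative sigma (at u))"
    by (rule linear_frechet_derivative)
  have "frechet_derivative sigma (at u) v = frechet_derivative sigma (at u) (\<Sum>i\<in>Basis. (v \<bullet> i) *\<^sub>R i)"
    by (simp only: euclidean_representation)
  also have "\<dots> = (\<Sum>i\<in>Basis. (v \<bullet> i) * frechet_derivative sigma (at u) i)"
    using lin by (simp add: linear_sum linear_scale)
  also have "\<bar>\<dots>\<bar> \<le> (\<Sum>i\<in>Basis. ?D i * norm v)"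
  proof (rule order_trans[OF sum_abs], rule sum_mono)
    fix i :: 'a assume i: "i \<in> Basis"
    show "\<bar>(v \<bullet> i) * frechet_derivative sigma (at u) i\<bar> \<le> ?D i * norm v"
      unfolding abs_mult using si[OF i] D0[OF i] Basis_le_norm[OF i, of v]
      by (subst mult.commute) (intro mult_mono; simp)
  qed
  also have "\<dots> = (\<Sum>i\<in>Basis. ?D i) * norm v"
    by (simp add: sum_distrib_right)
  also have "\<dots> \<le> triple_norm sigma * norm v"
    using s0 by (intro mult_right_mono) (auto simp: triple_norm_def)
  finally show "\<bar>frechet_derivative sigma (at u) v\<bar> \<le> triple_norm sigma * norm v" .
qed

text \<open>If |z - z'| exceeds |z|/2, the bound 2M on the difference suffices. Otherwise both
  points lie in the ball of radius |z|/2 about \<open>z\<close>, where |x| >= |z|/2 bounds the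
  gradient by 2M/|z|, and the mean value inequality applies.\<close>

lemma homogeneous_lipschitz:
  fixes sigma :: "'a::euclidean_space \<Rightarrow> real"
  assumes smooth: "smooth_on (- {0}) sigma"
    and hom: "\<And>t x. 0 < t \<Longrightarrow> x \<noteq> 0 \<Longrightarrow> sigma (t *\<^sub>R x) = sigma x"
    and M: "triple_norm sigma \<le> M"
  shows "z \<noteq> 0 \<Longrightarrow> \<bar>sigma z\<bar> \<le> M"
    and "z \<noteq> 0 \<Longrightarrow> z' \<noteq> 0 \<Longrightarrow> \<bar>sigma z - sigma z'\<bar> * norm z \<le> 4 * M * norm (z - z')"
proof -
  have hom': "sigma (x /\<^sub>R norm x) = sigma x" if "x \<noteq> 0" for x
    using hom[of "inverse (norm x)" x] that by simp
  have bound: "\<bar>sigma z\<bar> \<le> M" if "z \<noteq> 0" for z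
    using sigma_le_triple_norm(1)[OF smooth, of "z /\<^sub>R norm z"] M that hom'[OF that] by simp
  then show "z \<noteq> 0 \<Longrightarrow> \<bar>sigma z\<bar> \<le> M" .
  assume z: "z \<noteq> 0" and z': "z' \<noteq> 0"
  have M0: "0 \<le> M" using bound[OF z] by linarith
  show "\<bar>sigma z - sigma z'\<bar> * norm z \<le> 4 * M * norm (z - z')"
  proof (cases "norm (z - z') \<le> norm z / 2")
    case False
    have "\<bar>sigma z - sigma z'\<bar> * norm z \<le> (2 * M) * norm z"
      using bound[OF z] bound[OF z'] by (intro mult_right_mono) auto
    also have "\<dots> \<le> (2 * M) * (2 * norm (z - z'))"
      using False M0 by (intro mult_left_mono) auto
    finally show ?thesis by simp
  next
    case True
    let ?S = "cball z (norm z / 2)"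
    \<comment> \<open>The chain rule through y -> y / |x| with |x| frozen: homogeneity makes this
      composition equal to \<open>sigma\<close>, so the derivative at \<open>x\<close> is read off
      from the unit sphere.\<close>
    define f' where "f' x v = frechet_derivative sigma (at (x /\<^sub>R norm x)) (v /\<^sub>R norm x)" for x v
    have S: "norm z / 2 \<le> norm x" "x \<noteq> 0" if "x \<in> ?S" for x
    proof -
      show "norm z / 2 \<le> norm x"
        using that norm_triangle_ineq2[of z x] by (simp add: dist_norm)
      with z show "x \<noteq> 0" by auto
    qed
    have der: "(sigma has_derivative f' x) (at x within ?S)" if "x \<in> ?S" for x
    proof -
      have x: "x \<noteq> 0" using S[OF that] by simp
      have "sigma differentiable at (x /\<^sub>R norm x)"
        using x by (intro smooth_on_imp_differentiable[OF smooth]) auto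
      then have "(sigma has_derivative frechet_derivative sigma (at (x /\<^sub>R norm x))) (at (x /\<^sub>R norm x))"
        by (simp add: frechet_derivative_works)
      moreover have "((\<lambda>y. y /\<^sub>R norm x) has_derivative (\<lambda>v. v /\<^sub>R norm x)) (at x)"
        by (auto intro!: derivative_eq_intros)
      ultimately have "((\<lambda>y. sigma (y /\<^sub>R norm x)) has_derivative f' x) (at x)"
        unfolding f'_def by (rule has_derivative_compose[rotated])
      then have "(sigma has_derivative f' x) (at x)"
        by (rule has_derivative_transform_within_open[where s = "- {0}"]) (use x hom in auto)
      then show ?thesis by (rule has_derivative_at_withinI)
    qed
    have on: "onorm (f' x) \<le> 2 * M / norm z" if "x \<in> ?S" for x
    proof (rule onorm_le)
      fix v
      have "norm (f' x v) \<le> triple_norm sigma * norm (v /\<^sub>R norm x)"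
        unfolding f'_def real_norm_def using S[OF that]
        by (intro sigma_le_triple_norm(2)[OF smooth]) simp
      also have "\<dots> \<le> M * (norm v / norm x)"
        using M by (auto simp: divide_inverse_commute intro!: mult_right_mono)
      also have "\<dots> \<le> M * (norm v / (norm z / 2))"
        using M0 S[OF that] z by (intro mult_left_mono divide_left_mono) auto
      finally show "norm (f' x v) \<le> 2 * M / norm z * norm v" by (simp add: mult_ac)
    qed
    have "norm (sigma z - sigma z') \<le> 2 * M / norm z * norm (z - z')"
      using True der on by (intro differentiable_bound[where S = ?S]) (auto simp: dist_norm)
    then have "\<bar>sigma z - sigma z'\<bar> * norm z \<le> 2 * M * norm (z - z')"
      using z by (simp add: field_simps)
    also have "\<dots> \<le> 4 * M * norm (z - z')"
      using M0 by (intro mult_right_mono) auto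
    finally show ?thesis .
  qed
qed

text \<open>Nothing is assumed about \<open>sigma 0\<close>, so the value there is reset to 0. This
  leaves the kernel unchanged, and the Lipschitz condition at pairs involving 0 then follows from
  the bound \<open>M\<close>.\<close>

lemma singular_kernel_of_sigma:
  fixes sigma :: "'a::euclidean_space \<Rightarrow> real"
  assumes smooth: "smooth_on (- {0}) sigma"
    and hom: "\<And>t x. 0 < t \<Longrightarrow> x \<noteq> 0 \<Longrightarrow> sigma (t *\<^sub>R x) = sigma x"
    and mean: "sphere_integral sigma = 0"
    and M: "triple_norm sigma \<le> M"
  shows "singular_kernel (\<lambda>z. if z = 0 then 0 else sigma z) M"
proof -
  define s where "s z = (if z = 0 then 0 else sigma z)" for z
  note lip = homogeneous_lipschitz[OF smooth hom M]
  obtain b :: 'a where b: "b \<in> Basis" using nonempty_Basis by blast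
  have M0: "0 \<le> M" using lip(1)[of b] nonzero_Basis[OF b] by linarith
  have "continuous_on (- {0}) sigma"
    using smooth[unfolded smooth_on_def, rule_format, of 0] by simp
  then have "(\<lambda>x. if x \<in> {0} then 0 else sigma x) \<in> borel_measurable borel"
    by (intro borel_measurable_continuous_on_if) auto
  then have meas: "s \<in> borel_measurable borel"
    by (simp add: s_def[abs_def])
  have bound: "\<bar>s z\<bar> \<le> M" for z
    using lip(1)[of z] M0 by (simp add: s_def)
  have "integrable lborel (\<lambda>z. indicator (ball 0 1) z * s z)"
    using meas bound M0
    by (intro integrable_lborel_bounded_support[where B = M and D = 1] borel_measurable_times)
       (auto simp: indicator_def)
  then have "(s has_integral (\<integral>z. indicator (ball 0 1) z * s z \<partial>lborel)) (ball 0 1)"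
    by (rule has_integral_lborel_indicator)
  then have "(\<integral>z. indicator (ball 0 1) z * s z \<partial>lborel) = integral (ball 0 1) s"
    by (simp add: integral_unique)
  also have "\<dots> = integral (ball 0 1) (\<lambda>x. sigma (x /\<^sub>R norm x))"
    using hom by (intro integral_spike[of "{0}"]) (auto simp: s_def)
  also have "\<dots> = 0"
    using mean by (simp add: sphere_integral_def)
  finally have mean': "(\<integral>z. indicator (ball 0 1) z * s z \<partial>lborel) = 0" .
  have lip': "\<bar>s z - s z'\<bar> * norm z \<le> 4 * M * norm (z - z')" for z z'
  proof (cases "z = 0 \<or> z' = 0")
    case True
    then show ?thesis
    proof
      assume "z' = 0"
      then have "\<bar>s z - s z'\<bar> * norm z \<le> M * norm (z - z')"
        using bound[of z] by (simp add: s_def mult_right_mono)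
      also have "\<dots> \<le> 4 * M * norm (z - z')"
        using M0 by (intro mult_right_mono) auto
      finally show ?thesis .
    qed (use M0 in simp)
  qed (use lip(2)[of z z'] in \<open>simp add: s_def\<close>)
  have "singular_kernel s M"
    by standard (use meas bound mean' lip' hom in \<open>auto simp: s_def\<close>)
  then show ?thesis by (simp add: s_def[abs_def])
qed

section \<open>Moduli of continuity and seminorms on a ball\<close>

lemma modcont_upper:
  fixes f :: "'a::real_normed_vector \<Rightarrow> real"
  assumes "bounded (f ` E)" "x \<in> E" "y \<in> E" "0 < norm (x - y)" "norm (x - y) \<le> r"
  shows "\<bar>f x - f y\<bar> \<le> modcont E f r"
  unfolding modcont_def
proof (rule cSup_upper)
  from assms(1) obtain B where B: "\<And>x. x \<in> E \<Longrightarrow> \<bar>f x\<bar> \<le> B"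
    unfolding bounded_iff by auto
  show "bdd_above {\<bar>f x - f y\<bar> |x y. x \<in> E \<and> y \<in> E \<and> 0 < norm (x - y) \<and> norm (x - y) \<le> r}"
  proof (rule bdd_aboveI)
    fix t assume "t \<in> {\<bar>f x - f y\<bar> |x y. x \<in> E \<and> y \<in> E \<and> 0 < norm (x - y) \<and> norm (x - y) \<le> r}"
    then obtain x y where "t = \<bar>f x - f y\<bar>" "x \<in> E" "y \<in> E" by blast
    with B[of x] B[of y] show "t \<le> 2 * B" by linarith
  qed
qed (use assms in blast)

lemma wsemi_modulus:
  fixes f :: "'a::real_normed_vector \<Rightarrow> real"
  assumes inD: "inD w R E f" and E: "compact E"
    and w: "\<And>r. 0 < r \<Longrightarrow> r < R \<Longrightarrow> 0 < w r"
    and xy: "x \<in> E" "y \<in> E" "0 < norm (x - y)" "norm (x - y) < R"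
  shows "\<bar>f x - f y\<bar> \<le> wsemi w R E f * w (norm (x - y))"
proof -
  let ?r = "norm (x - y)"
  have "compact (f ` E)"
    using inD E by (auto simp: inD_def intro: compact_continuous_image)
  then have "\<bar>f x - f y\<bar> \<le> modcont E f ?r"
    using xy by (intro modcont_upper compact_imp_bounded) auto
  moreover have "modcont E f ?r / w ?r \<le> wsemi w R E f"
    unfolding wsemi_def using inD xy by (intro cSUP_upper) (auto simp: inD_def)
  ultimately show ?thesis
    using w[of ?r] xy by (simp add: divide_le_eq)
qed

text \<open>A ball of positive radius contains two distinct points at distance less than
  \<open>R\<close>; the modulus inequality at such a pair, with \<open>w\<close> positive, fixes the
  sign.\<close>

lemma wsemi_nonneg:
  fixes f :: "'a::euclidean_space \<Rightarrow> real"
  assumes inD: "inD w R (cball 0 rho) f" and "0 < rho" "0 < R"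
    and w: "\<And>r. 0 < r \<Longrightarrow> r < R \<Longrightarrow> 0 < w r"
  shows "0 \<le> wsemi w R (cball 0 rho) f"
proof -
  obtain b :: 'a where b: "b \<in> Basis" using nonempty_Basis by blast
  define r where "r = min rho (R / 2)"
  have r: "0 < r" "r \<le> rho" "r < R" using assms by (auto simp: r_def)
  have "\<bar>f (r *\<^sub>R b) - f 0\<bar> \<le> wsemi w R (cball 0 rho) f * w (norm (r *\<^sub>R b - 0))"
    using r b assms by (intro wsemi_modulus inD w) auto
  then have "0 \<le> wsemi w R (cball 0 rho) f * w r"
    using r b by simp
  then show ?thesis using w[of r] r by (simp add: zero_le_mult_iff)
qed

lemma wsemi_le:
  fixes f :: "'a::euclidean_space \<Rightarrow> real"
  assumes R: "0 < R" and rho: "0 < rho" and C: "0 \<le> C"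
    and v: "\<And>r. 0 < r \<Longrightarrow> r < R \<Longrightarrow> 0 \<le> v r"
    and le: "\<And>x y r. x \<in> cball 0 rho \<Longrightarrow> y \<in> cball 0 rho \<Longrightarrow> 0 < norm (x - y) \<Longrightarrow> norm (x - y) \<le> r \<Longrightarrow> r < R
      \<Longrightarrow> \<bar>f x - f y\<bar> \<le> C * v r"
  shows "bdd_above ((\<lambda>r. modcont (cball 0 rho) f r / v r) ` {0<..<R})"
    and "wsemi v R (cball 0 rho) f \<le> C"
proof -
  obtain b :: 'a where b: "b \<in> Basis" using nonempty_Basis by blast
  have *: "modcont (cball 0 rho) f r / v r \<le> C" if r: "r \<in> {0<..<R}" for r
  proof -
    have "modcont (cball 0 rho) f r \<le> C * v r"
      unfolding modcont_def
    proof (rule cSup_least)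
      \<comment> \<open>The points 0 and \<open>?t *\<^sub>R b\<close> show that the supremum is
        over a nonempty set.\<close>
      let ?t = "min r rho"
      have "?t *\<^sub>R b \<in> cball 0 rho" "0 \<in> cball (0::'a) rho" "0 < norm (?t *\<^sub>R b - 0)" "norm (?t *\<^sub>R b - 0) \<le> r"
        using r rho b by auto
      then show "{\<bar>f x - f y\<bar> |x y. x \<in> cball 0 rho \<and> y \<in> cball 0 rho \<and> 0 < norm (x - y) \<and> norm (x - y) \<le> r} \<noteq> {}"
        by blast
    qed (use le r in auto)
    \<comment> \<open>Where \<open>v r = 0\<close> the quotient is 0 by convention, and
      \<open>0 <= C\<close> is enough.\<close>
    then show ?thesis
      using v[of r] r C by (cases "v r = 0") (auto simp: divide_le_eq)
  qed
  show "bdd_above ((\<lambda>r. modcont (cball 0 rho) f r / v r) ` {0<..<R})"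
    using * by (intro bdd_aboveI[of _ C]) auto
  show "wsemi v R (cball 0 rho) f \<le> C"
    unfolding wsemi_def using * R by (intro cSUP_least) auto
qed

text \<open>The segment is cut into \<open>N\<close> equal steps. Convexity keeps them in
  \<open>E\<close>, and |x - y| < R <= N r0 makes each shorter than \<open>r0\<close>. A local
  estimate thus reaches all distances below \<open>R\<close> at the price of a factor
  \<open>N\<close> that does not depend on \<open>E\<close>.\<close>

lemma modulus_chain:
  fixes f :: "'a::real_normed_vector \<Rightarrow> real"
  assumes E: "convex E" and N: "0 < N" "R \<le> real N * r0"
    and K: "0 \<le> K" and v: "\<And>r r'. 0 < r \<Longrightarrow> r \<le> r' \<Longrightarrow> r' < R \<Longrightarrow> v r \<le> v r'"
    and le: "\<And>x y. x \<in> E \<Longrightarrow> y \<in> E \<Longrightarrow> 0 < norm (x - y) \<Longrightarrow> norm (x - y) < r0 \<Longrightarrow> \<bar>f x - f y\<bar> \<le> K * v (norm (x - y))"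
    and xy: "x \<in> E" "y \<in> E" "0 < norm (x - y)" "norm (x - y) \<le> r" "r < R"
  shows "\<bar>f x - f y\<bar> \<le> real N * K * v r"
proof -
  define p where "p k = x + (real k / real N) *\<^sub>R (y - x)" for k
  have pE: "p k \<in> E" if "k \<le> N" for k
  proof -
    have "p k = (1 - real k / real N) *\<^sub>R x + (real k / real N) *\<^sub>R y"
      by (simp add: p_def algebra_simps)
    also have "\<dots> \<in> E"
      using that N xy by (intro convexD[OF E]) auto
    finally show ?thesis .
  qed
  have step: "norm (p k - p (Suc k)) = norm (x - y) / real N" for k
  proof -
    have "p k - p (Suc k) = (1 / real N) *\<^sub>R (x - y)"
      using N by (simp add: p_def add_divide_distrib algebra_simps)
    then show ?thesis by simp
  qed
  have d: "0 < norm (x - y) / real N" "norm (x - y) / real N < r0" "norm (x - y) / real N \<le> r"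
  proof -
    show "0 < norm (x - y) / real N" using xy N by simp
    show "norm (x - y) / real N < r0"
      using xy N by (simp add: divide_less_eq mult.commute)
    have "norm (x - y) / real N \<le> norm (x - y) / 1"
      using N by (intro divide_left_mono) auto
    then show "norm (x - y) / real N \<le> r" using xy by simp
  qed
  have "\<bar>f x - f (p k)\<bar> \<le> real k * K * v r" if "k \<le> N" for k
    using that
  proof (induction k)
    case (Suc k)
    have "\<bar>f (p k) - f (p (Suc k))\<bar> \<le> K * v (norm (x - y) / real N)"
      using le[of "p k" "p (Suc k)"] Suc.prems d by (simp add: pE step)
    also have "\<dots> \<le> K * v r"
      using d xy K by (intro mult_left_mono v) auto
    finally show ?case
      using Suc by (simp add: algebra_simps)
  qed (simp add: p_def)
  from this[of N] show ?thesis
    using N by (simp add: p_def)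
qed

text \<open>If one point lies in the ball and the other outside, the segment between them meets the
  sphere of radius \<open>rho\<close>, where \<open>phi\<close> already vanishes. The outer point
  can be replaced by that crossing point, which is no farther away.\<close>

lemma zero_extension:
  fixes phi :: "'a::euclidean_space \<Rightarrow> real"
  assumes inD: "inD w R (cball 0 rho) phi" and rho: "0 < rho" and R: "0 < R"
    and w_pos: "\<And>r. 0 < r \<Longrightarrow> r < R \<Longrightarrow> 0 < w r"
    and w_mono: "\<And>r r'. 0 \<le> r \<Longrightarrow> r \<le> r' \<Longrightarrow> r' < R \<Longrightarrow> w r \<le> w r'"
    and supp: "\<And>y. rho \<le> norm y \<Longrightarrow> phi y = 0"
  shows "phi \<in> borel_measurable borel"
    and "\<And>y. \<bar>phi y\<bar> \<le> (SUP x\<in>cball 0 rho. \<bar>phi x\<bar>)"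
    and "\<And>x y. 0 < norm (x - y) \<Longrightarrow> norm (x - y) < R \<Longrightarrow>
      \<bar>phi x - phi y\<bar> \<le> wsemi w R (cball 0 rho) phi * w (norm (x - y))"
proof -
  have cont: "continuous_on (cball 0 rho) phi"
    using inD by (simp add: inD_def)
  have "(\<lambda>x. if x \<in> cball 0 rho then phi x else 0) \<in> borel_measurable borel"
    using cont by (intro borel_measurable_continuous_on_if) auto
  moreover have "(\<lambda>x. if x \<in> cball 0 rho then phi x else 0) = phi"
    using supp by auto
  ultimately show "phi \<in> borel_measurable borel" by simp
  have bdd: "bdd_above ((\<lambda>x. \<bar>phi x\<bar>) ` cball 0 rho)"
    by (intro bounded_imp_bdd_above compact_imp_bounded compact_continuous_image continuous_intros cont) simp
  show "\<bar>phi y\<bar> \<le> (SUP x\<in>cball 0 rho. \<bar>phi x\<bar>)" for y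
  proof (cases "y \<in> cball 0 rho")
    case True
    then show ?thesis using bdd by (rule cSUP_upper)
  next
    case False
    have "\<bar>phi 0\<bar> \<le> (SUP x\<in>cball 0 rho. \<bar>phi x\<bar>)"
      using rho bdd by (intro cSUP_upper) auto
    then show ?thesis using False supp[of y] by simp
  qed
  let ?L = "wsemi w R (cball 0 rho) phi"
  have L: "0 \<le> ?L"
    using inD rho R w_pos by (rule wsemi_nonneg)
  have crossing: "\<bar>phi x - phi y\<bar> \<le> ?L * w (norm (x - y))"
    if xy: "0 < norm (x - y)" "norm (x - y) < R" and x: "x \<in> cball 0 rho" and y: "y \<notin> cball 0 rho" for x y
  proof -
    have "connected (norm ` closed_segment x y)"
      by (intro connected_continuous_image continuous_intros) auto
    then have "rho \<in> norm ` closed_segment x y"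
      by (rule connectedD_interval[where x = "norm x" and y = "norm y"]) (use x y in simp_all)
    then obtain z where z: "z \<in> closed_segment x y" "norm z = rho" by auto
    have pz: "phi z = 0" "phi y = 0" using z y supp by auto
    have zx: "norm (x - z) \<le> norm (x - y)"
      using segment_bound(1)[OF z(1)] by (simp add: norm_minus_commute)
    show ?thesis
    proof (cases "x = z")
      case True
      then show ?thesis using pz L w_pos[of "norm (x - y)"] xy by simp
    next
      case False
      have "\<bar>phi x - phi z\<bar> \<le> ?L * w (norm (x - z))"
        using False zx xy x z by (intro wsemi_modulus inD w_pos) auto
      also have "\<dots> \<le> ?L * w (norm (x - y))"
        using zx xy L by (intro mult_left_mono w_mono) auto
      finally show ?thesis by (simp add: pz)
    qed
  qed
  show "\<bar>phi x - phi y\<bar> \<le> ?L * w (norm (x - y))" if xy: "0 < norm (x - y)" "norm (x - y) < R" for x y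
  proof (cases "x \<in> cball 0 rho"; cases "y \<in> cball 0 rho")
    assume "x \<in> cball 0 rho" "y \<in> cball 0 rho"
    then show ?thesis using xy by (intro wsemi_modulus inD w_pos) auto
  next
    assume "x \<in> cball 0 rho" "y \<notin> cball 0 rho"
    then show ?thesis using xy by (intro crossing)
  next
    assume "x \<notin> cball 0 rho" "y \<in> cball 0 rho"
    then show ?thesis using crossing[of y x] xy by (simp add: norm_minus_commute abs_minus_commute)
  next
    assume "x \<notin> cball 0 rho" "y \<notin> cball 0 rho"
    then show ?thesis using supp[of x] supp[of y] L w_pos[of "norm (x - y)"] xy by simp
  qed
qed

section \<open>Choice of scale and of the final constant\<close>

lemma dini_scale:
  assumes osc: "oscillation_function w R"
    and a: "(\<lambda>r. w r / r) integrable_on {0<..<R}"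
    and b: "filterlim (\<lambda>r. w r / r) at_top (at_right 0)"
    and d: "eventually (\<lambda>r. r * integral {r..<R} (\<lambda>s. w s / s\<^sup>2) / hat w r \<le> C2) (at_right 0)"
  obtains r0 where "0 < r0" "r0 < R" "\<And>r. 0 < r \<Longrightarrow> r < r0 \<Longrightarrow> r \<le> hat w r"
    "\<And>r. 0 < r \<Longrightarrow> r < r0 \<Longrightarrow> r * integral {r..<R} (\<lambda>s. w s / s\<^sup>2) \<le> C2 * hat w r"
proof -
  interpret dini_modulus w R by standard (fact osc, fact a)
  have "eventually (\<lambda>r. 1 \<le> w r / r) (at_right 0)"
    using b by (simp add: filterlim_at_top)
  then obtain r1 where r1: "0 < r1" "\<And>r. 0 < r \<Longrightarrow> r < r1 \<Longrightarrow> 1 \<le> w r / r"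
    by (auto simp: eventually_at_right_field)
  from d obtain r2 where r2: "0 < r2"
    "\<And>r. 0 < r \<Longrightarrow> r < r2 \<Longrightarrow> r * integral {r..<R} (\<lambda>s. w s / s\<^sup>2) / hat w r \<le> C2"
    by (auto simp: eventually_at_right_field)
  \<comment> \<open>Below both neighbourhoods supplied by (b) and (d), and below
    \<open>R\<close>.\<close>
  define r0 where "r0 = Min {r1, r2, R / 2}"
  have r0: "0 < r0" "r0 \<le> r1" "r0 \<le> r2" "r0 < R"
    using r1(1) r2(1) R_pos by (auto simp: r0_def min_def)
  have ge: "r \<le> hat w r" if "0 < r" "r < r0" for r
    using that r0 by (intro hat_ge r1(2)) auto
  show ?thesis
  proof (rule that[OF r0(1,4)])
    fix r assume r: "0 < r" "r < r0"
    show "r \<le> hat w r" by (rule ge[OF r])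
    \<comment> \<open>Positivity of the denominator turns the quotient in (d) into a product
      inequality.\<close>
    have "0 < hat w r" using ge[OF r] r by linarith
    then show "r * integral {r..<R} (\<lambda>s. w s / s\<^sup>2) \<le> C2 * hat w r"
      using r2(2)[of r] r r0 by (simp add: divide_le_eq)
  qed
qed

text \<open>In \<open>K\<close> the 2 comes from the two \<open>near\<close> integrals, and 1,
  \<open>C2\<close> and \<open>2 / R\<close> from the three ranges of the increment integral;
  \<open>N\<close> is the number of steps in the chain. None of these depends on \<open>rho\<close>
  or \<open>phi\<close>.\<close>

lemma singular_integral_bound:
  fixes sigma :: "'a::euclidean_space \<Rightarrow> real"
  assumes osc: "oscillation_function w R"
    and a: "(\<lambda>r. w r / r) integrable_on {0<..<R}"
    and r0: "0 < r0" "r0 < R" "\<And>r. 0 < r \<Longrightarrow> r < r0 \<Longrightarrow> r \<le> hat w r"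
      "\<And>r. 0 < r \<Longrightarrow> r < r0 \<Longrightarrow> r * integral {r..<R} (\<lambda>s. w s / s\<^sup>2) \<le> C2 * hat w r"
    and C2: "0 \<le> C2" and N: "0 < N" "R \<le> real N * r0"
    and sigma: "smooth_on (- {0}) sigma" "\<And>t x. 0 < t \<Longrightarrow> x \<noteq> 0 \<Longrightarrow> sigma (t *\<^sub>R x) = sigma x"
      "sphere_integral sigma = 0" "triple_norm sigma \<le> M"
    and rho: "0 < rho" and phi: "inD w R (cball 0 rho) phi" and supp: "\<And>y. rho \<le> norm y \<Longrightarrow> phi y = 0"
  defines "K \<equiv> sphere_area TYPE('a) * M * (2 + lip_const TYPE('a) * (1 + C2 + 2 / R))"
  shows "\<exists>f. (\<forall>x\<in>cball 0 rho. pv_conv_at sigma phi x (f x)) \<and> inD (hat w) R (cball 0 rho) f \<and>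
    wsemi (hat w) R (cball 0 rho) f \<le> real N * K * wnorm w R (cball 0 rho) phi"
proof -
  let ?E = "cball (0::'a) rho"
  define s where "s z = (if z = 0 then 0 else sigma z)" for z
  define L where "L = wsemi w R ?E phi"
  define B where "B = (SUP x\<in>?E. \<bar>phi x\<bar>)"
  interpret dini_modulus w R by standard (fact osc, fact a)
  have L0: "0 \<le> L"
    unfolding L_def by (rule wsemi_nonneg[OF phi rho R_pos w_pos])
  interpret singular_kernel s M
    using singular_kernel_of_sigma[OF sigma] by (simp add: s_def[abs_def])
  interpret singular_integral s M w R phi rho L B
    using zero_extension[OF phi rho R_pos w_pos w_mono supp] supp L0
    by unfold_locales (auto simp: L_def B_def)
  have kernel_eq: "kernel sigma = kernel s"
    by (auto simp: kernel_def s_def)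
  \<comment> \<open>By \<open>potential_eq\<close> any splitting radius in (0, R) defines the same
    function.\<close>
  define f where "f = potential r0"
  have K0: "0 \<le> K"
    using sphere_area_nonneg[where 'a='a] M_nonneg lip_const_pos[where 'a='a] C2 R_pos by (simp add: K_def)
  have local: "\<bar>f x - f y\<bar> \<le> K * (L + B) * hat w (norm (x - y))"
    if xy: "0 < norm (x - y)" "norm (x - y) < r0" for x y
  proof -
    define h where "h = norm (x - y)"
    have h: "0 < h" "h < r0" using xy by (auto simp: h_def)
    have hh: "0 \<le> hat w h" using r0(3)[OF h] h by linarith
    let ?T = "integral {h..<R} (\<lambda>s. w s / s\<^sup>2)"
    have "\<bar>f x - f y\<bar> \<le> sphere_area TYPE('a) * M * (2 * L * hat w h +
        lip_const TYPE('a) * (L * hat w h + h * L * ?T + 2 * B * h / R))"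
      using potential_modulus[of "y - x" r0 x] xy r0(1,2)
      by (simp add: f_def h_def norm_minus_commute)
    also have "\<dots> \<le> sphere_area TYPE('a) * M * (2 * ((L + B) * hat w h) +
        lip_const TYPE('a) * ((L + B) * hat w h + C2 * ((L + B) * hat w h) + 2 / R * ((L + B) * hat w h)))"
    proof -
      have 1: "L * hat w h \<le> (L + B) * hat w h"
        using hh B_nonneg by (intro mult_right_mono) auto
      have "h * L * ?T = L * (h * ?T)" by simp
      also have "\<dots> \<le> L * (C2 * hat w h)"
        using L0 r0(4)[OF h] by (rule mult_left_mono[rotated])
      also have "\<dots> = C2 * (L * hat w h)" by simp
      also have "\<dots> \<le> C2 * ((L + B) * hat w h)"
        using 1 C2 by (rule mult_left_mono)
      finally have 2: "h * L * ?T \<le> C2 * ((L + B) * hat w h)" .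
      \<comment> \<open>The linear term is absorbed through \<open>h <= hat w h\<close>.\<close>
      have "B * h \<le> (L + B) * hat w h"
        using r0(3)[OF h] h L0 B_nonneg by (intro mult_mono) auto
      then have 3: "2 * B * h / R \<le> 2 / R * ((L + B) * hat w h)"
        using R_pos by (simp add: divide_right_mono)
      show ?thesis
        using 1 2 3 sphere_area_nonneg[where 'a='a] M_nonneg lip_const_pos[where 'a='a]
        by (intro mult_left_mono add_mono) auto
    qed
    also have "\<dots> = K * (L + B) * hat w h"
      by (simp add: K_def algebra_simps add_divide_distrib)
    finally show ?thesis by (simp add: h_def)
  qed
  have C0: "0 \<le> K * (L + B)" "0 \<le> real N * (K * (L + B))"
    using K0 L0 B_nonneg by auto
  have glob: "\<bar>f x - f y\<bar> \<le> real N * (K * (L + B)) * hat w r"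
    if "x \<in> ?E" "y \<in> ?E" "0 < norm (x - y)" "norm (x - y) \<le> r" "r < R" for x y r
    by (rule modulus_chain[where E = ?E and r = r and v = "hat w", OF convex_cball N C0(1)])
       (use that in \<open>auto intro: local hat_mono\<close>)
  have cont: "continuous_on ?E f"
    unfolding continuous_on_def
  proof
    fix x assume "x \<in> ?E"
    have "((\<lambda>y. norm (x - y)) \<longlongrightarrow> 0) (at x within ?E)"
      by (rule tendsto_eq_intros refl | simp)+
    then have lim0: "filterlim (\<lambda>y. norm (x - y)) (at_right 0) (at x within ?E)"
      by (auto simp: filterlim_at eventually_at_filter)
    have lim: "((\<lambda>y. K * (L + B) * hat w (norm (x - y))) \<longlongrightarrow> 0) (at x within ?E)"
      using tendsto_mult_right_zero[OF filterlim_compose[OF hat_tendsto_0 lim0]] by simp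
    have "eventually (\<lambda>y. norm (f y - f x) \<le> K * (L + B) * hat w (norm (x - y))) (at x within ?E)"
      unfolding eventually_at
      by (rule exI[of _ r0]) (use r0(1) local[of x] in \<open>auto simp: dist_norm norm_minus_commute abs_minus_commute\<close>)
    from Lim_null_comparison[OF this lim] show "(f \<longlongrightarrow> f x) (at x within ?E)"
      by (simp add: LIM_zero_iff)
  qed
  have semi: "bdd_above ((\<lambda>r. modcont ?E f r / hat w r) ` {0<..<R})"
    "wsemi (hat w) R ?E f \<le> real N * (K * (L + B))"
    by (intro wsemi_le[OF R_pos rho C0(2)] hat_nonneg glob; simp)+
  show ?thesis
  proof (intro exI conjI ballI)
    show "pv_conv_at sigma phi x (f x)" for x
      using pv_potential[OF r0(1,2), of x] by (simp add: pv_conv_at_def kernel_eq f_def)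
    show "inD (hat w) R ?E f"
      using cont semi(1) by (simp add: inD_def)
    show "wsemi (hat w) R ?E f \<le> real N * K * wnorm w R ?E phi"
      using semi(2) by (simp add: wnorm_def L_def B_def mult.assoc)
  qed
qed

theorem theorem4p1:
  fixes w :: "real \<Rightarrow> real" and R :: real
  assumes osc: "oscillation_function w R"
    and a: "(\<lambda>r. w r / r) integrable_on {0<..<R}"
    and b: "filterlim (\<lambda>r. w r / r) at_top (at_right 0)"
    and c: "\<exists>k1>1. \<exists>c1>0. eventually (\<lambda>r. w (k1 * r) \<le> c1 * w r) (at_right 0)"
    and d: "\<exists>C2>0. eventually (\<lambda>r. r * integral {r..<R} (\<lambda>s. w s / s\<^sup>2)
                 / integral {0..r} (\<lambda>s. w s / s) \<le> C2) (at_right 0)"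
  shows "\<forall>M. \<exists>C. \<forall>(sigma :: 'a::euclidean_space \<Rightarrow> real) (rho :: real) (phi :: 'a \<Rightarrow> real).
           smooth_on (- {0}) sigma
         \<and> (\<forall>t>0. \<forall>x. x \<noteq> 0 \<longrightarrow> sigma (t *\<^sub>R x) = sigma x)
         \<and> sphere_integral sigma = 0
         \<and> triple_norm sigma \<le> M
         \<and> rho > 0
         \<and> inD w R (cball 0 rho) phi
         \<and> (\<forall>y. rho \<le> norm y \<longrightarrow> phi y = 0)
         \<longrightarrow> (\<exists>f. (\<forall>x\<in>cball 0 rho. pv_conv_at sigma phi x (f x))
                 \<and> inD (\<lambda>r. integral {0..r} (\<lambda>s. w s / s)) R (cball 0 rho) f
                 \<and> wsemi (\<lambda>r. integral {0..r} (\<lambda>s. w s / s)) R (cball 0 rho) f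
                     \<le> C * wnorm w R (cball 0 rho) phi)"
proof -
  obtain C2 where C2: "0 < C2"
    "eventually (\<lambda>r. r * integral {r..<R} (\<lambda>s. w s / s\<^sup>2) / hat w r \<le> C2) (at_right 0)"
    using d unfolding hat_def by blast
  obtain r0 where r0: "0 < r0" "r0 < R" "\<And>r. 0 < r \<Longrightarrow> r < r0 \<Longrightarrow> r \<le> hat w r"
    "\<And>r. 0 < r \<Longrightarrow> r < r0 \<Longrightarrow> r * integral {r..<R} (\<lambda>s. w s / s\<^sup>2) \<le> C2 * hat w r"
    using dini_scale[OF osc a b C2(2)] by metis
  \<comment> \<open>The chain length is fixed from \<open>R\<close> and \<open>r0\<close> before
    \<open>sigma\<close>, \<open>rho\<close> and \<open>phi\<close> appear, which keeps the constant
    uniform in them.\<close>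
  obtain N :: nat where "R / r0 < real N"
    using reals_Archimedean2 by blast
  moreover from this have "0 < N"
    using r0(1,2) by (intro gr0I) (auto simp: divide_less_0_iff)
  ultimately have N: "0 < N" "R \<le> real N * r0"
    using r0(1) by (auto simp: divide_less_eq)
  \<comment> \<open>Linear in \<open>M\<close>; the remaining factors depend only on the dimension,
    on \<open>w\<close> and on \<open>R\<close>.\<close>
  let ?C = "\<lambda>M. real N * (sphere_area TYPE('a) * M * (2 + lip_const TYPE('a) * (1 + C2 + 2 / R)))"
  have hat_eq: "(\<lambda>r. integral {0..r} (\<lambda>s. w s / s)) = hat w"
    by (simp add: hat_def[abs_def])
  show ?thesis
    unfolding hat_eq
  proof (rule allI, rule exI, intro allI impI)
    fix M rho :: real and sigma phi :: "'a \<Rightarrow> real"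
    assume H: "smooth_on (- {0}) sigma \<and> (\<forall>t>0. \<forall>x. x \<noteq> 0 \<longrightarrow> sigma (t *\<^sub>R x) = sigma x)
      \<and> sphere_integral sigma = 0 \<and> triple_norm sigma \<le> M \<and> rho > 0
      \<and> inD w R (cball 0 rho) phi \<and> (\<forall>y. rho \<le> norm y \<longrightarrow> phi y = 0)"
    show "\<exists>f. (\<forall>x\<in>cball 0 rho. pv_conv_at sigma phi x (f x)) \<and> inD (hat w) R (cball 0 rho) f
      \<and> wsemi (hat w) R (cball 0 rho) f \<le> ?C M * wnorm w R (cball 0 rho) phi"
      by (rule singular_integral_bound[OF osc a r0 less_imp_le[OF C2(1)] N]) (use H in \<open>simp_all only:, blast+\<close>)
  qed
qed

end
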